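(* Let $n\ge 4$. In the transversal achievement game on the $n\times n$ board, the strategy for the first player X described in the context is well defined at every ply (every choice it calls for is available), and X, following it, wins against every play of O by ply $2n+3$, i.e. no later than with X's $(n+2)$-nd stone.
   Context: Game. The board has row set $R$ and column set $C$, $|R|=|C|=n$; cells are pairs $(r,c)\in R\times C$. Players X (first) and O (second) alternately claim (place a stone on) a free cell, i.e. a cell occupied by neither player; X's $k$-th stone is placed at ply $2k-1$, O's $k$-th stone at ply $2k$. A matching is a set of cells no two of which share a row or a column; a transversal is a matching of size $n$. For a set $S$ of cells, $\nu(S)$ is the maximum size of a matching contained in $S$. The first player whose set $S$ of stones satisfies $\nu(S)=n$ wins. A cell $f$ completes $S$ if $\nu(S\cup\{f\})=n$. Strategy of X. Phase 1 (X's moves $1,\dots,n-2$). At any time let $U_R,U_C$ be the sets of rows, resp. columns, containing no X-stone, and let $H=U_R\times U_C$ (the open block). Move $1$: any cell. Move $k$ ($2\le k\le n-2$): let $x$ be O's most recent stone; if $x\in H$, play a free cell of $H$ in $x$'s row; otherwise play any free cell of $H$. Tie-break (X's move $n-1$). Just before this move $H=\{u_1,u_2\}\times\{v_1,v_2\}$. Let $F$ be the set of the $n-2$ O-stones already placed. If X plays $(u_a,v_c)$ with $a,c\in\{1,2\}$, put $(b,d)=(u_{3-a},v_{3-c})$ (the outcome). A cell of $H$ is admissible if it is free and its opposite corner in $H$ is free; an outcome is admissible if it comes from an admissible cell. For an outcome $(b,d)$ let $w=|F\cap(\text{row }b\cup\text{column }d)|$. X chooses an admissible outcome with $1\le w\le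 n-3$ if one exists; otherwise any admissible outcome with $w\le n-3$. Phase 2. After move $n-1$ (ply $2n-3$) X's stones form a matching $M$ of size $n-1$ missing exactly row $b$ and column $d$; let $\sigma:R\setminus\{b\}\to C\setminus\{d\}$ be the induced bijection, so $M=\{(i,\sigma(i)):i\neq b\}$. A row $s\in R\setminus\{b\}$ is live if $(s,d)$ and $(b,\sigma(s))$ are both free right after ply $2n-3$. For distinct live rows $r,s$: plan (i) is to play $(b,\sigma(r))$ at ply $2n-1$ and $(s,d)$ at ply $2n+1$, and the pair $(r,s)$ is admissible for plan (i) if the cross cell $(r,\sigma(s))$ is free right after ply $2n-3$; plan (ii) is to play $(r,d)$ at ply $2n-1$ and $(b,\sigma(s))$ at ply $2n+1$, and the pair is admissible for plan (ii) if the cross cell $(s,\sigma(r))$ is free right after ply $2n-3$. Choice of plan and pair: if $F$ meets column $d$, use plan (i) with any admissible pair; else if $F$ meets row $b$, use plan (ii) with any admissible pair; else ($w=0$), if $\nu(F)\le n-3$ use plan (i) with any admissible pair, and if $\nu(F)=n-2$ use plan (i) with $s:=u_a$ (the row of X's move $n-1$) and any live $r\ne u_a$. Deviation rule. If O at ply $2n-2$, $2n$ or $2n+2$ leaves free some cell that completes X's set, X immediately plays such a cell (in particular at ply $2n+3$ X plays a remaining free completing cell); otherwise X continues the plan. *)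

theory Defs
  imports Main
begin

type_synonym ('r, 'c) cell = "'r \<times> 'c"

definition matching :: "('r, 'c) cell set \<Rightarrow> bool" where
  "matching S \<longleftrightarrow>
     (\<forall>p\<in>S. \<forall>q\<in>S. p \<noteq> q \<longrightarrow> fst p \<noteq> fst q \<and> snd p \<noteq> snd q)"

text \<open>Only meaningful for finite \<open>S\<close>; it is applied only to finite sets of stones.\<close>

definition max_matching :: "('r, 'c) cell set \<Rightarrow> nat" (\<open>\<nu>\<close>) where
  "\<nu> S = Max (card ` {T. T \<subseteq> S \<and> matching T})"

text \<open>
  A position is the list of all cells claimed so far, in order of play: the stone placed at
  ply \<open>p\<close> is the list element with index \<open>p - 1\<close>.  X owns the even indices.
\<close>

definition X_stones :: "('r, 'c) cell list \<Rightarrow> ('r, 'c) cell set" where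
  "X_stones h = {h ! i | i. i < length h \<and> even i}"

definition O_stones :: "('r, 'c) cell list \<Rightarrow> ('r, 'c) cell set" where
  "O_stones h = {h ! i | i. i < length h \<and> odd i}"

datatype plan = Plan_i | Plan_ii

text \<open>
  The two cells a plan plays (at plies \<open>2n - 1\<close> and \<open>2n + 1\<close>) for the pair \<open>(r, s)\<close>,
  and its cross cell, where \<open>(b, d)\<close> is the outcome and \<open>\<sigma>\<close> the induced bijection.
\<close>

fun plan_cells :: "'r \<Rightarrow> 'c \<Rightarrow> ('r \<Rightarrow> 'c) \<Rightarrow> plan \<Rightarrow> 'r \<Rightarrow> 'r \<Rightarrow> ('r, 'c) cell \<times> ('r, 'c) cell" where
  "plan_cells b d \<sigma> Plan_i r s = ((b, \<sigma> r), (s, d))"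
| "plan_cells b d \<sigma> Plan_ii r s = ((r, d), (b, \<sigma> s))"

fun cross_cell :: "('r \<Rightarrow> 'c) \<Rightarrow> plan \<Rightarrow> 'r \<Rightarrow> 'r \<Rightarrow> ('r, 'c) cell" where
  "cross_cell \<sigma> Plan_i r s = (r, \<sigma> s)"
| "cross_cell \<sigma> Plan_ii r s = (s, \<sigma> r)"

locale transversal_game =
  fixes R :: "'r set" and C :: "'c set" and n :: nat
  assumes finite_R: "finite R" and finite_C: "finite C"
    and card_R: "card R = n" and card_C: "card C = n"
begin

definition free :: "('r, 'c) cell list \<Rightarrow> ('r, 'c) cell set" where
  "free h = R \<times> C - (X_stones h \<union> O_stones h)"

definition game_over :: "('r, 'c) cell list \<Rightarrow> bool" where
  "game_over h \<longleftrightarrow> \<nu> (X_stones h) = n \<or> \<nu> (O_stones h) = n"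

definition won_by_X :: "('r, 'c) cell list \<Rightarrow> bool" where
  "won_by_X h \<longleftrightarrow>
     (\<exists>k\<le>length h. \<nu> (X_stones (take k h)) = n \<and> (\<forall>j\<le>k. \<nu> (O_stones (take j h)) \<noteq> n))"

definition completing :: "('r, 'c) cell list \<Rightarrow> ('r, 'c) cell set" where
  "completing h = {f \<in> free h. \<nu> (X_stones h \<union> {f}) = n}"

definition open_rows :: "('r, 'c) cell list \<Rightarrow> 'r set" where
  "open_rows h = {r \<in> R. \<forall>p\<in>X_stones h. fst p \<noteq> r}"

definition open_cols :: "('r, 'c) cell list \<Rightarrow> 'c set" where
  "open_cols h = {c \<in> C. \<forall>p\<in>X_stones h. snd p \<noteq> c}"

definition open_block :: "('r, 'c) cell list \<Rightarrow> ('r, 'c) cell set" where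
  "open_block h = open_rows h \<times> open_cols h"

definition phase1_cells :: "('r, 'c) cell list \<Rightarrow> ('r, 'c) cell set" where
  "phase1_cells h =
     (if h = [] then free h
      else if last h \<in> open_block h
        then {p \<in> free h \<inter> open_block h. fst p = fst (last h)}
      else free h \<inter> open_block h)"

text \<open>
  \<open>outcome h p q\<close>: the open block of \<open>h\<close> is a \<open>2 \<times> 2\<close> block with opposite corners \<open>p\<close> and
  \<open>q\<close>, so that playing \<open>p\<close> has outcome \<open>q\<close>.
\<close>

definition outcome :: "('r, 'c) cell list \<Rightarrow> ('r, 'c) cell \<Rightarrow> ('r, 'c) cell \<Rightarrow> bool" where
  "outcome h p q \<longleftrightarrow>
     open_rows h = {fst p, fst q} \<and> fst p \<noteq> fst q \<and>
     open_cols h = {snd p, snd q} \<and> snd p \<noteq> snd q"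

definition admissible_outcome ::
    "('r, 'c) cell list \<Rightarrow> ('r, 'c) cell \<Rightarrow> ('r, 'c) cell \<Rightarrow> bool" where
  "admissible_outcome h p q \<longleftrightarrow> outcome h p q \<and> p \<in> free h \<and> q \<in> free h"

definition weight :: "('r, 'c) cell set \<Rightarrow> ('r, 'c) cell \<Rightarrow> nat" where
  "weight F q = card {f \<in> F. fst f = fst q \<or> snd f = snd q}"

definition tie_break_cells :: "('r, 'c) cell list \<Rightarrow> ('r, 'c) cell set" where
  "tie_break_cells h =
     (let w = weight (O_stones h) in
      if \<exists>p q. admissible_outcome h p q \<and> 1 \<le> w q \<and> w q \<le> n - 3
      then {p. \<exists>q. admissible_outcome h p q \<and> 1 \<le> w q \<and> w q \<le> n - 3}
      else {p. \<exists>q. admissible_outcome h p q \<and> w q \<le> n - 3})"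

text \<open>In the following, \<open>g\<close> is the position right after ply \<open>2n - 3\<close>.\<close>

definition induced_bijection ::
    "('r, 'c) cell list \<Rightarrow> 'r \<Rightarrow> 'c \<Rightarrow> ('r \<Rightarrow> 'c) \<Rightarrow> bool" where
  "induced_bijection g b d \<sigma> \<longleftrightarrow>
     b \<in> R \<and> d \<in> C \<and> bij_betw \<sigma> (R - {b}) (C - {d}) \<and>
     X_stones g = {(i, \<sigma> i) | i. i \<in> R - {b}}"

definition live :: "('r, 'c) cell list \<Rightarrow> 'r \<Rightarrow> 'c \<Rightarrow> ('r \<Rightarrow> 'c) \<Rightarrow> 'r \<Rightarrow> bool" where
  "live g b d \<sigma> s \<longleftrightarrow> s \<in> R - {b} \<and> (s, d) \<in> free g \<and> (b, \<sigma> s) \<in> free g"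

text \<open>The stones of O in \<open>g\<close> are exactly \<open>F\<close>, and \<open>last g\<close> is move \<open>n - 1\<close> of X.\<close>

definition plan_choice ::
    "('r, 'c) cell list \<Rightarrow> 'r \<Rightarrow> 'c \<Rightarrow> ('r \<Rightarrow> 'c) \<Rightarrow> plan \<Rightarrow> 'r \<Rightarrow> 'r \<Rightarrow> bool" where
  "plan_choice g b d \<sigma> P r s \<longleftrightarrow>
     live g b d \<sigma> r \<and> live g b d \<sigma> s \<and> r \<noteq> s \<and>
     (let F = O_stones g; admissible = (cross_cell \<sigma> P r s \<in> free g) in
      if \<exists>f\<in>F. snd f = d then P = Plan_i \<and> admissible
      else if \<exists>f\<in>F. fst f = b then P = Plan_ii \<and> admissible
      else if \<nu> F \<le> n - 3 then P = Plan_i \<and> admissible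
      else \<nu> F = n - 2 \<and> P = Plan_i \<and> s = fst (last g))"

text \<open>
  The moves the strategy permits at X's turn, each with the cell X intends to play next
  according to the plan.  The intended cell \<open>m\<close> is the only memory the strategy needs besides
  the position: the pair \<open>(r, s)\<close> is chosen once, at ply \<open>2n - 1\<close>, and determines the move at
  ply \<open>2n + 1\<close>.  Freeness of the cells prescribed by a plan is deliberately not built in: it is
  part of what has to be proved.
\<close>

definition X_moves ::
    "('r, 'c) cell list \<Rightarrow> ('r, 'c) cell option \<Rightarrow>
      (('r, 'c) cell \<times> ('r, 'c) cell option) set" where
  "X_moves h m =
     (let k = length h div 2 + 1 in
      if k \<le> n - 2 then {(p, None) | p. p \<in> phase1_cells h}
      else if k = n - 1 then {(p, None) | p. p \<in> tie_break_cells h}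
      else if completing h \<noteq> {} then {(p, m) | p. p \<in> completing h}
      else if k = n then
        (let g = take (2 * n - 3) h in
         {(p, Some p') | p p'. \<exists>b d \<sigma> P r s. induced_bijection g b d \<sigma> \<and>
            plan_choice g b d \<sigma> P r s \<and> (p, p') = plan_cells b d \<sigma> P r s})
      else if k = n + 1 then {(p, None) | p. m = Some p}
      else {})"

text \<open>
  The plays (with the memory of X) in which X follows the strategy, for every way of resolving
  its free choices, and O makes arbitrary legal moves.  Play stops as soon as a player has won.
\<close>

inductive play :: "('r, 'c) cell list \<Rightarrow> ('r, 'c) cell option \<Rightarrow> bool" where
  start: "play [] None"
| X_move: "\<lbrakk>play h m; \<not> game_over h; even (length h); (p, m') \<in> X_moves h m\<rbrakk>
    \<Longrightarrow> play (h @ [p]) m'"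
| O_move: "\<lbrakk>play h m; \<not> game_over h; odd (length h); p \<in> free h\<rbrakk>
    \<Longrightarrow> play (h @ [p]) m"

definition strategy_well_defined :: bool where
  "strategy_well_defined \<longleftrightarrow>
     (\<forall>h m. play h m \<and> \<not> game_over h \<and> even (length h) \<longrightarrow>
        X_moves h m \<noteq> {} \<and> (\<forall>(p, m')\<in>X_moves h m. p \<in> free h))"

text \<open>No play lasts longer than \<open>N\<close> plies, and every play that has ended (because a player has
  won or because the board is full) is a win for X.\<close>

definition strategy_wins_by_ply :: "nat \<Rightarrow> bool" where
  "strategy_wins_by_ply N \<longleftrightarrow>
     (\<forall>h m. play h m \<longrightarrow> length h \<le> N \<and> (game_over h \<or> free h = {} \<longrightarrow> won_by_X h))"

end

end

theory Submission
  imports Defs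
begin

text \<open>
  In Phase 1 X answers inside O's row of the open block, so after each move of X the open block
  contains no O-stone.  Hence the last \<open>2 \<times> 2\<close> block contains at most one, and a free diagonal
  of it has an endpoint whose cross misses some stone of \<open>F\<close> (an O-stone lying on both crosses
  would be one of the other two corners).  After the tie-break O must take \<open>(b, d)\<close>.  Every stone
  of \<open>F\<close> either kills at most one row or spoils at most one cross cell, and counting leaves an
  admissible pair.  The first plan move forces O's reply, the second creates two threats.
  O's two forced stones lie in one line, which costs O one stone; a third stone of \<open>F\<close> in that
  line, or \<open>\<nu> F \<le> n - 3\<close>, costs O another, so that even \<open>n + 1\<close> stones contain no
  transversal.  In the remaining case the tie-break guarantees that \<open>F\<close> avoids the row and the
  column of X's tie-break stone \<open>p\<close>, so O would need the cell \<open>p\<close>, which X owns.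
\<close>

section \<open>Matchings\<close>

lemma Diff_eq_singletonD:
  assumes "B - A = {x}" "A \<subseteq> B"
  shows "A = B - {x}" and "x \<in> B"
  using assms double_diff[of A B B] by auto

lemma matching_subset: "matching S \<Longrightarrow> T \<subseteq> S \<Longrightarrow> matching T"
  unfolding matching_def by blast

lemma matching_inj_on:
  assumes "matching S"
  shows "inj_on fst S" and "inj_on snd S"
  using assms by (auto simp: matching_def intro!: inj_onI)

lemma card_le_max_matching:
  assumes "finite S" "T \<subseteq> S" "matching T"
  shows "card T \<le> \<nu> S"
  unfolding max_matching_def using assms by (intro Max_ge) auto

lemma max_matching_attained:
  assumes "finite S"
  obtains T where "T \<subseteq> S" "matching T" "card T = \<nu> S"
proof -
  have "\<nu> S \<in> card ` {T. T \<subseteq> S \<and> matching T}"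
    unfolding max_matching_def
  proof (rule Max_in)
    have "{} \<in> {T. T \<subseteq> S \<and> matching T}" by (simp add: matching_def)
    then show "card ` {T. T \<subseteq> S \<and> matching T} \<noteq> {}" by blast
  qed (use assms in simp)
  then obtain T where "T \<subseteq> S \<and> matching T" "\<nu> S = card T" by blast
  then show thesis by (intro that[of T]) simp_all
qed

lemma max_matching_le_card:
  assumes "finite S"
  shows "\<nu> S \<le> card S"
  by (rule max_matching_attained[OF assms]) (metis assms card_mono)

lemma max_matching_mono:
  assumes "finite S'" "S \<subseteq> S'"
  shows "\<nu> S \<le> \<nu> S'"
proof -
  have "finite S" using assms finite_subset by blast
  then obtain T where "T \<subseteq> S" "matching T" "card T = \<nu> S"
    by (rule max_matching_attained)
  then show ?thesis using card_le_max_matching[of S' T] assms by auto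
qed

text \<open>A matching has at most one cell in a row or a column, so a set \<open>B\<close> inside
  one line adds at most one. The disjunction lets the same bound serve rows and columns.\<close>

lemma max_matching_Un_line:
  assumes "finite A" "finite B"
    and "(\<forall>p\<in>B. fst p = i) \<or> (\<forall>p\<in>B. snd p = j)"
  shows "\<nu> (A \<union> B) \<le> \<nu> A + 1"
proof -
  have "finite (A \<union> B)" using assms by simp
  then obtain T where T: "T \<subseteq> A \<union> B" "matching T" "card T = \<nu> (A \<union> B)"
    by (rule max_matching_attained)
  have fin: "finite T" using T(1) assms(1,2) by (meson finite_UnI finite_subset)
  have "\<forall>p\<in>T \<inter> B. \<forall>q\<in>T \<inter> B. p = q"
    using assms(3) T(2) unfolding matching_def by (metis Int_iff)
  then have "card (T \<inter> B) \<le> 1"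
    using card_le_Suc0_iff_eq[of "T \<inter> B"] fin by simp
  moreover have "card (T \<inter> A) \<le> \<nu> A"
    using T(2) assms(1) by (intro card_le_max_matching) (auto intro: matching_subset)
  moreover have "card T \<le> card (T \<inter> A) + card (T \<inter> B)"
  proof -
    have "T = (T \<inter> A) \<union> (T \<inter> B)" using T(1) by blast
    then show ?thesis by (metis card_Un_le)
  qed
  ultimately show ?thesis using T(3) by linarith
qed

lemma max_matching_insert: "finite A \<Longrightarrow> \<nu> (insert x A) \<le> \<nu> A + 1"
  using max_matching_Un_line[of A "{x}" "fst x"] by simp

section \<open>Positions\<close>

lemma X_stones_Nil [simp]: "X_stones [] = {}"
  by (simp add: X_stones_def)

lemma O_stones_Nil [simp]: "O_stones [] = {}"
  by (simp add: O_stones_def)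

lemma nth_set_snoc:
  "{(h @ [p]) ! i | i. i < length (h @ [p]) \<and> Q i} =
     (if Q (length h) then insert p {h ! i | i. i < length h \<and> Q i}
      else {h ! i | i. i < length h \<and> Q i})"
proof -
  let ?I = "{i. i < length h \<and> Q i}"
  have "{i. i < length (h @ [p]) \<and> Q i} = (if Q (length h) then insert (length h) ?I else ?I)"
    by (auto simp: less_Suc_eq)
  moreover have "(!) (h @ [p]) ` ?I = (!) h ` ?I"
    by (intro image_cong) (auto simp: nth_append)
  ultimately have "(!) (h @ [p]) ` {i. i < length (h @ [p]) \<and> Q i} =
      (if Q (length h) then insert p ((!) h ` ?I) else (!) h ` ?I)" by simp
  then show ?thesis by (simp only: image_Collect)
qed

lemma X_stones_snoc [simp]:
  "X_stones (h @ [p]) = (if even (length h) then insert p (X_stones h) else X_stones h)"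
  unfolding X_stones_def by (rule nth_set_snoc)

lemma O_stones_snoc [simp]:
  "O_stones (h @ [p]) = (if even (length h) then O_stones h else insert p (O_stones h))"
  unfolding O_stones_def nth_set_snoc by simp

text \<open>A prefix of odd length interchanges the owners of the stones in the tail.\<close>

lemma stones_append:
  "X_stones (h @ l) = X_stones h \<union> (if even (length h) then X_stones l else O_stones l)"
  "O_stones (h @ l) = O_stones h \<union> (if even (length h) then O_stones l else X_stones l)"
proof (induction l rule: rev_induct)
  case (snoc x l)
  {
    case 1
    show ?case using snoc by (simp flip: append_assoc)
  next
    case 2
    show ?case using snoc by (simp flip: append_assoc)
  }
qed simp_all

lemma stones_Cons [simp]:
  "X_stones (x # l) = insert x (O_stones l)"
  "O_stones (x # l) = X_stones l"
  using X_stones_snoc[of "[]" x] O_stones_snoc[of "[]" x] stones_append[of "[x]" l] by simp_all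

lemma stones_Un: "X_stones h \<union> O_stones h = set h"
  by (induction h rule: rev_induct) auto

lemma X_stones_subset: "X_stones h \<subseteq> set h" and O_stones_subset: "O_stones h \<subseteq> set h"
  using stones_Un[of h] by blast+

lemma finite_stones [simp]: "finite (X_stones h)" "finite (O_stones h)"
  by (rule finite_subset[OF X_stones_subset finite_set],
      rule finite_subset[OF O_stones_subset finite_set])

lemma card_stones:
  assumes "distinct h"
  shows "card (X_stones h) = (length h + 1) div 2"
    and "card (O_stones h) = length h div 2"
proof -
  have "card (X_stones h) = (length h + 1) div 2 \<and> card (O_stones h) = length h div 2"
    using assms
  proof (induction h rule: rev_induct)
    case (snoc p h)
    then have "p \<notin> X_stones h" "p \<notin> O_stones h"
      using X_stones_subset[of h] O_stones_subset[of h] by auto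
    moreover have "length h = 2 * (length h div 2) \<or> length h = 2 * (length h div 2) + 1"
      by presburger
    then obtain k where "length h = 2 * k \<or> length h = 2 * k + 1" by blast
    ultimately show ?case using snoc by auto
  qed simp
  then show "card (X_stones h) = (length h + 1) div 2"
    and "card (O_stones h) = length h div 2" by auto
qed

text \<open>Repeated cells only lower the count, so the bound holds for every list. It shows that O
  has fewer than \<open>n\<close> stones before ply \<open>2 * n\<close>.\<close>

lemma card_O_stones_le: "card (O_stones h) \<le> length h div 2"
proof (induction h rule: rev_induct)
  case (snoc p h)
  have "length h = 2 * (length h div 2) \<or> length h = 2 * (length h div 2) + 1"
    by presburger
  then obtain k where "length h = 2 * k \<or> length h = 2 * k + 1" by blast
  moreover have "card (insert p (O_stones h)) \<le> Suc (card (O_stones h))"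
    by (simp add: card_insert_if)
  ultimately show ?case using snoc by auto
qed simp

section \<open>Transversals of the board, the open block, and reading a play backwards\<close>

context transversal_game
begin

lemma free_eq: "free h = R \<times> C - set h"
  by (simp add: free_def stones_Un)

lemma max_matching_board_le:
  assumes "S \<subseteq> R \<times> C"
  shows "\<nu> S \<le> n"
proof -
  have "finite S" using assms finite_R finite_C by (meson finite_SigmaI finite_subset)
  then obtain T where T: "T \<subseteq> S" "matching T" "card T = \<nu> S"
    by (rule max_matching_attained)
  have "card T = card (fst ` T)" using T(2) by (simp add: card_image matching_inj_on)
  also have "\<dots> \<le> card R" using T(1) assms finite_R by (intro card_mono) auto
  finally show ?thesis using T(3) card_R by simp
qed

text \<open>A transversal enters as the graph of an injective column choice \<tau>, so that X's
  later ones can be written as pointwise updates of \<sigma>.\<close>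

lemma max_matching_transversal:
  assumes "S \<subseteq> R \<times> C" "inj_on \<tau> R" "\<And>i. i \<in> R \<Longrightarrow> (i, \<tau> i) \<in> S"
  shows "\<nu> S = n"
proof -
  have fin: "finite S" using assms(1) finite_R finite_C by (meson finite_SigmaI finite_subset)
  let ?T = "(\<lambda>i. (i, \<tau> i)) ` R"
  have "matching ?T" using assms(2) by (auto simp: matching_def inj_on_def)
  then have "card ?T \<le> \<nu> S" using assms(3) fin by (intro card_le_max_matching) auto
  moreover have "card ?T = n" using card_R by (simp add: card_image inj_on_def)
  ultimately show ?thesis using max_matching_board_le[OF assms(1)] by simp
qed

text \<open>Pigeonhole: \<open>n\<close> cells in distinct rows exhaust the \<open>n\<close> rows,
  and likewise for columns. This turns a row that O cannot cover into a proof that O has no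
  transversal.\<close>

lemma transversal_covers:
  assumes "T \<subseteq> R \<times> C" "matching T" "card T = n"
  shows "fst ` T = R" and "snd ` T = C"
proof -
  show "fst ` T = R"
    using assms finite_R card_R
    by (intro card_subset_eq) (auto simp: card_image matching_inj_on)
  show "snd ` T = C"
    using assms finite_C card_C
    by (intro card_subset_eq) (auto simp: card_image matching_inj_on)
qed

lemma open_rows_eq: "open_rows h = R - fst ` X_stones h"
  unfolding open_rows_def by auto

lemma open_cols_eq: "open_cols h = C - snd ` X_stones h"
  unfolding open_cols_def by auto

lemma card_open:
  assumes "X_stones h \<subseteq> R \<times> C" "matching (X_stones h)"
  shows "card (open_rows h) = n - card (X_stones h)"
    and "card (open_cols h) = n - card (X_stones h)"
proof -
  have "fst ` X_stones h \<subseteq> R" "snd ` X_stones h \<subseteq> C" using assms(1) by auto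
  then show "card (open_rows h) = n - card (X_stones h)"
    and "card (open_cols h) = n - card (X_stones h)"
    unfolding open_rows_eq open_cols_eq
    using assms(2) card_R card_C
    by (simp_all add: card_Diff_subset card_image matching_inj_on)
qed

lemma open_block_free:
  assumes "x \<in> open_block h" "x \<notin> O_stones h"
  shows "x \<in> free h"
  using assms unfolding open_block_def open_rows_def open_cols_def free_def by auto

lemma matching_insert_open:
  assumes "matching (X_stones h)" "p \<in> open_block h"
  shows "matching (insert p (X_stones h))"
  using assms unfolding matching_def open_block_def open_rows_def open_cols_def
  by (auto; metis)

lemma play_snocD:
  assumes "play (h @ [p]) m'"
  obtains m where "play h m" "\<not> game_over h"
    "if even (length h) then (p, m') \<in> X_moves h m else p \<in> free h \<and> m = m'"
  using assms by (cases rule: play.cases) auto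

lemma play_SucD:
  assumes "play h m'" "length h = Suc k"
  obtains h' p m where "h = h' @ [p]" "length h' = k" "play h' m" "\<not> game_over h'"
    "if even k then (p, m') \<in> X_moves h' m else p \<in> free h' \<and> m = m'"
proof -
  obtain h' p where h: "h = h' @ [p]" "length h' = k"
    using assms(2) by (metis length_Suc_conv_rev)
  with assms(1) that show thesis by (metis play_snocD)
qed

lemma completingD:
  assumes "c \<in> completing h"
  shows "c \<in> free h" and "\<nu> (insert c (X_stones h)) = n"
  using assms by (simp_all add: completing_def)

lemma completingI:
  assumes "c \<in> free h" "\<nu> (insert c (X_stones h)) = n"
  shows "c \<in> completing h"
  using assms by (simp add: completing_def)

lemma X_moves_completing:
  assumes "n \<le> length h div 2 + 1" "n \<ge> 2" "completing h \<noteq> {}"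
  shows "X_moves h m = {(c, m) | c. c \<in> completing h}"
proof -
  have "\<not> length h div 2 + 1 \<le> n - 2" "length h div 2 + 1 \<noteq> n - 1" using assms by linarith+
  then show ?thesis using assms(3) unfolding X_moves_def Let_def by simp
qed

lemma play_prefix:
  assumes "play h m" "k \<le> length h"
  shows "\<exists>m'. play (take k h) m'"
  using assms
proof (induction h arbitrary: m rule: rev_induct)
  case (snoc p h)
  then obtain m'' where "play h m''" by (blast elim: play_snocD)
  then show ?case using snoc by (cases "k \<le> length h") (auto simp: le_Suc_eq)
qed auto

lemma O_stones_take_subset: "O_stones (take j h) \<subseteq> O_stones h"
proof
  fix x assume "x \<in> O_stones (take j h)"
  then obtain i where "x = take j h ! i" "i < length (take j h)" "odd i"
    unfolding O_stones_def by blast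
  then have "x = h ! i \<and> i < length h \<and> odd i" by simp
  then show "x \<in> O_stones h" unfolding O_stones_def by blast
qed

text \<open>O's stones only accumulate, so a final \<nu> below \<open>n\<close> excludes an earlier
  transversal of O. A finished game was therefore ended by X, and the full length is a witness for
  \<open>won_by_X\<close>.\<close>

lemma won_by_X_if:
  assumes "\<nu> (O_stones h) < n" "game_over h"
  shows "won_by_X h"
proof -
  have O: "\<nu> (O_stones (take j h)) \<noteq> n" for j
    using max_matching_mono[OF finite_stones(2) O_stones_take_subset, of j h] assms(1)
    by linarith
  have "\<nu> (X_stones (take (length h) h)) = n"
    using assms by (simp add: game_over_def)
  with O show ?thesis unfolding won_by_X_def by blast
qed

section \<open>Phase 1 and the tie-break\<close>

text \<open>With O to move the open block is free of O-stones; with X to move, O's latest stone is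
  the only possible exception. For \<open>h = []\<close> the unspecified \<open>last h\<close> does
  no harm, because O has no stones yet.\<close>

definition phase1_inv :: "('r, 'c) cell list \<Rightarrow> bool" where
  "phase1_inv h \<longleftrightarrow> set h \<subseteq> R \<times> C \<and> distinct h \<and> matching (X_stones h) \<and>
     O_stones h \<inter> open_block h \<subseteq> (if even (length h) then {last h} else {})"

lemma phase1_inv_card_open:
  assumes "phase1_inv h" "even (length h)"
  shows "card (open_rows h) = n - length h div 2"
    and "card (open_cols h) = n - length h div 2"
proof -
  have "X_stones h \<subseteq> R \<times> C" "matching (X_stones h)" "card (X_stones h) = length h div 2"
    using assms X_stones_subset[of h] card_stones(1)[of h] by (auto simp: phase1_inv_def)
  then show "card (open_rows h) = n - length h div 2"
    and "card (open_cols h) = n - length h div 2" using card_open by auto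
qed

lemma phase1_cells_open:
  assumes "p \<in> phase1_cells h"
  shows "p \<in> free h" and "p \<in> open_block h"
  using assms unfolding phase1_cells_def
  by (auto split: if_splits simp: free_def open_block_def open_rows_def open_cols_def)

text \<open>The block has at least two columns and holds at most one O-stone, namely the last one.
  If that stone lies in the block, its row has a free cell in another column; otherwise the whole
  block is free.\<close>

lemma phase1_cells_nonempty:
  assumes "phase1_inv h" "even (length h)" "length h div 2 + 2 \<le> n"
  shows "phase1_cells h \<noteq> {}"
proof -
  have cards: "card (open_rows h) \<ge> 2" "card (open_cols h) \<ge> 2"
    using phase1_inv_card_open[OF assms(1,2)] assms(3) by auto
  have O: "O_stones h \<inter> open_block h \<subseteq> {last h}"
    using assms by (auto simp: phase1_inv_def)
  obtain i where i: "i \<in> open_rows h" using cards(1) by fastforce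
  have "\<exists>j\<in>open_cols h. j \<noteq> c" for c
  proof -
    have "\<not> open_cols h \<subseteq> {c}" using cards(2) card_mono[of "{c}" "open_cols h"] by auto
    then show ?thesis by blast
  qed
  note j = this
  show ?thesis
  proof (cases "last h \<in> open_block h")
    case True
    obtain c where c: "c \<in> open_cols h" "c \<noteq> snd (last h)" using j by blast
    have mem: "(fst (last h), c) \<in> open_block h"
      using True c by (auto simp: open_block_def)
    moreover have "(fst (last h), c) \<notin> O_stones h"
      using O mem c(2) by (metis IntI insertE singletonD snd_conv subsetD empty_iff)
    ultimately have "(fst (last h), c) \<in> phase1_cells h"
      unfolding phase1_cells_def using True open_block_free by auto
    then show ?thesis by blast
  next
    case False
    obtain c where c: "c \<in> open_cols h" using j by blast
    have mem: "(i, c) \<in> open_block h" using i c by (auto simp: open_block_def)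
    moreover have "(i, c) \<notin> O_stones h" using O mem False by auto
    ultimately have "(i, c) \<in> phase1_cells h"
      unfolding phase1_cells_def using False open_block_free by auto
    then show ?thesis by blast
  qed
qed

text \<open>X's stone closes its own row. The one O-stone that may lie in the block is in that row
  and so drops out of the block with it.\<close>

lemma phase1_inv_X_move:
  assumes "phase1_inv h" "even (length h)" "p \<in> phase1_cells h"
  shows "phase1_inv (h @ [p])"
proof -
  note p = phase1_cells_open[OF assms(3)]
  have sub: "open_block (h @ [p]) \<subseteq> {x \<in> open_block h. fst x \<noteq> fst p}"
    using assms(2) by (auto simp: open_block_def open_rows_eq open_cols_eq)
  have O: "O_stones h \<inter> open_block h \<subseteq> {last h}"
    using assms by (auto simp: phase1_inv_def)
  have "O_stones h \<inter> open_block (h @ [p]) = {}"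
  proof (cases "h \<noteq> [] \<and> last h \<in> open_block h")
    case True
    then have "fst p = fst (last h)" using assms(3) by (auto simp: phase1_cells_def)
    then have "fst x \<noteq> fst (last h)" if "x \<in> open_block (h @ [p])" for x
      using that sub by auto
    then show ?thesis using sub O by blast
  next
    case False
    have "open_block (h @ [p]) \<subseteq> open_block h" using sub by blast
    then show ?thesis using False O by (cases "h = []") (simp, blast)
  qed
  then show ?thesis
    using assms(1,2) p matching_insert_open[of h p]
    by (auto simp: phase1_inv_def free_eq)
qed

lemma phase1_inv_O_move:
  assumes "phase1_inv h" "odd (length h)" "p \<in> free h"
  shows "phase1_inv (h @ [p])"
proof -
  have "open_block (h @ [p]) = open_block h"
    using assms(2) by (simp add: open_block_def open_rows_eq open_cols_eq)
  then show ?thesis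
    using assms by (auto simp: phase1_inv_def free_eq)
qed

lemma outcome_sym: "outcome h p q \<Longrightarrow> outcome h q p"
  unfolding outcome_def by auto

lemma outcome_open:
  assumes "outcome h p q"
  shows "open_block h = {p, q, (fst p, snd q), (fst q, snd p)}"
  using assms unfolding outcome_def open_block_def by (cases p; cases q) auto

end

section \<open>Boards with \<open>n \<ge> 4\<close>: the tie-break on the last open block\<close>

locale large_transversal_game = transversal_game R C n
  for R :: "'r set" and C :: "'c set" and n :: nat +
  assumes n_ge_4: "n \<ge> 4"
begin

text \<open>\<open>2 * n + 3 < 4 * n \<le> n * n\<close>, so the board is never full within the
  plies considered and a draw cannot occur.\<close>

lemma free_nonempty:
  assumes "length h \<le> 2 * n + 3"
  shows "free h \<noteq> {}"
proof
  assume "free h = {}"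
  then have "R \<times> C \<subseteq> set h" by (auto simp: free_eq)
  then have "n * n \<le> card (set h)"
    using card_mono[of "set h" "R \<times> C"] card_R card_C by (simp add: card_cartesian_product)
  also have "\<dots> \<le> 2 * n + 3" using card_length[of h] assms by linarith
  also have "\<dots> < 4 * n" using n_ge_4 by simp
  also have "\<dots> \<le> n * n" using n_ge_4 by simp
  finally show False by simp
qed

lemma play_phase1_inv:
  assumes "play h m" "length h \<le> 2 * n - 4"
  shows "phase1_inv h"
  using assms
proof (induction rule: play.induct)
  case start
  then show ?case by (simp add: phase1_inv_def matching_def)
next
  case (X_move h m p m')
  \<comment> \<open>Evenness sharpens \<open>length h + 1 \<le> 2 * n - 4\<close> to
    \<open>length h \<le> 2 * n - 6\<close>, so X's move still belongs to Phase 1.\<close>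
  have "length h div 2 + 1 \<le> n - 2"
    using X_move.prems X_move.hyps(3) n_ge_4 by (simp; presburger)
  then have "p \<in> phase1_cells h" using X_move.hyps(4) by (auto simp: X_moves_def)
  then show ?case using X_move phase1_inv_X_move by simp
next
  case (O_move h m p)
  then show ?case using phase1_inv_O_move by simp
qed

text \<open>Weight above \<open>n - 3\<close> means that the cross contains all \<open>n - 2\<close>
  stones of O. If this held at both ends of a diagonal, every stone would lie on both crosses, hence
  in the open block, which holds at most one O-stone, whereas \<open>n - 2 \<ge> 2\<close>.\<close>

lemma admissible_outcome_light:
  assumes inv: "phase1_inv h" and len: "length h = 2 * n - 4"
    and "outcome h p q" "p \<in> free h" "q \<in> free h"
  shows "\<exists>p q. admissible_outcome h p q \<and> weight (O_stones h) q \<le> n - 3"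
proof (rule ccontr)
  let ?F = "O_stones h"
  assume neg: "\<not> ?thesis"
  have cF: "card ?F = n - 2" using inv len card_stones(2)[of h] by (auto simp: phase1_inv_def)
  have all: "\<forall>f\<in>?F. fst f = fst x \<or> snd f = snd x"
    if x: "\<not> weight ?F x \<le> n - 3" for x
  proof -
    let ?G = "{f \<in> ?F. fst f = fst x \<or> snd f = snd x}"
    have "card ?F \<le> card ?G" using x cF by (simp add: weight_def)
    then have "?G = ?F" by (intro card_seteq) auto
    then show ?thesis by blast
  qed
  have "\<not> weight ?F p \<le> n - 3" "\<not> weight ?F q \<le> n - 3"
    using neg assms(3-5) outcome_sym[OF assms(3)] unfolding admissible_outcome_def by blast+
  note pq = all[OF this(1)] all[OF this(2)]
  have "?F \<subseteq> open_block h"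
  proof
    fix f assume "f \<in> ?F"
    then have "fst f = fst p \<or> snd f = snd p" "fst f = fst q \<or> snd f = snd q"
      using pq by blast+
    then have "f \<in> {p, q, (fst p, snd q), (fst q, snd p)}"
      using assms(3) by (cases f; cases p; cases q) (auto simp: outcome_def)
    then show "f \<in> open_block h" using outcome_open[OF assms(3)] by blast
  qed
  then have "?F \<subseteq> {last h}"
    using inv len by (auto simp: phase1_inv_def)
  then have "card ?F \<le> 1" using card_mono[of "{last h}" ?F] by simp
  then show False using cF n_ge_4 by simp
qed

lemma tie_break_nonempty:
  assumes inv: "phase1_inv h" and len: "length h = 2 * n - 4"
  shows "tie_break_cells h \<noteq> {}"
proof -
  have "length h div 2 = n - 2" using len by presburger
  then have "card (open_rows h) = 2" "card (open_cols h) = 2"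
    using phase1_inv_card_open[OF inv] len n_ge_4 by auto
  then obtain u1 u2 v1 v2 where uv: "open_rows h = {u1, u2}" "u1 \<noteq> u2"
    "open_cols h = {v1, v2}" "v1 \<noteq> v2" by (auto simp: card_2_iff)
  have o1: "outcome h (u1, v1) (u2, v2)" using uv by (auto simp: outcome_def)
  have o2: "outcome h (u1, v2) (u2, v1)" using uv by (auto simp: outcome_def)
  have O: "O_stones h \<inter> open_block h \<subseteq> {last h}"
    using inv len by (auto simp: phase1_inv_def)
  then have fr: "x \<in> free h" if "x \<in> open_block h" "x \<noteq> last h" for x
    using that open_block_free by blast
  have blk: "open_block h = {(u1, v1), (u2, v2), (u1, v2), (u2, v1)}"
    using outcome_open[OF o1] unfolding fst_conv snd_conv .
  \<comment> \<open>The two diagonals are disjoint and at most one corner is taken, so one diagonal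
    is free.\<close>
  have "\<exists>p q. outcome h p q \<and> p \<in> free h \<and> q \<in> free h"
  proof (cases "last h \<in> {(u1, v1), (u2, v2)}")
    case True
    then have "(u1, v2) \<noteq> last h" "(u2, v1) \<noteq> last h" using uv(2,4) by auto
    then have "(u1, v2) \<in> free h" "(u2, v1) \<in> free h"
      by (intro fr; simp add: blk)+
    then show ?thesis using o2 by blast
  next
    case False
    then have "(u1, v1) \<noteq> last h" "(u2, v2) \<noteq> last h" by auto
    then have "(u1, v1) \<in> free h" "(u2, v2) \<in> free h"
      by (intro fr; simp add: blk)+
    then show ?thesis using o1 by blast
  qed
  then obtain p q where pq: "admissible_outcome h p q" "weight (O_stones h) q \<le> n - 3"
    using admissible_outcome_light[OF inv len] by blast
  show ?thesis
  proof (cases "\<exists>p q. admissible_outcome h p q \<and> 1 \<le> weight (O_stones h) q \<and>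
      weight (O_stones h) q \<le> n - 3")
    case True
    then show ?thesis unfolding tie_break_cells_def Let_def if_P[OF True] by blast
  next
    case False
    then show ?thesis unfolding tie_break_cells_def Let_def if_not_P[OF False] using pq by blast
  qed
qed

text \<open>Both branches of the tie-break in one form: weight 0 is accepted only when no light
  admissible outcome has positive weight. In the first branch the implication is vacuous.\<close>

lemma tie_break_cellsD:
  assumes "p \<in> tie_break_cells h"
  obtains q where "admissible_outcome h p q" "weight (O_stones h) q \<le> n - 3"
    "weight (O_stones h) q = 0 \<longrightarrow>
       (\<forall>p' q'. admissible_outcome h p' q' \<longrightarrow> weight (O_stones h) q' \<le> n - 3 \<longrightarrow>
          weight (O_stones h) q' = 0)"
proof (cases "\<exists>p q. admissible_outcome h p q \<and> 1 \<le> weight (O_stones h) q \<and>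
    weight (O_stones h) q \<le> n - 3")
  case True
  then obtain q where q: "admissible_outcome h p q" "1 \<le> weight (O_stones h) q"
    "weight (O_stones h) q \<le> n - 3"
    using assms unfolding tie_break_cells_def Let_def if_P[OF True] by blast
  then have "weight (O_stones h) q \<noteq> 0" by linarith
  then show thesis by (intro that[OF q(1,3)]) blast
next
  case False
  then obtain q where q: "admissible_outcome h p q" "weight (O_stones h) q \<le> n - 3"
    using assms unfolding tie_break_cells_def Let_def if_not_P[OF False] by blast
  have "weight (O_stones h) q' = 0"
    if "admissible_outcome h p' q'" "weight (O_stones h) q' \<le> n - 3" for p' q'
  proof (rule ccontr)
    assume "weight (O_stones h) q' \<noteq> 0"
    then have "1 \<le> weight (O_stones h) q'" by simp
    with False that show False by blast
  qed
  then show thesis by (intro that[OF q]) blast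
qed

lemma open_after_outcome:
  assumes "outcome h p q" "even (length h)"
  shows "open_rows (h @ [p]) = {fst q}" and "open_cols (h @ [p]) = {snd q}"
proof -
  have "open_rows (h @ [p]) = open_rows h - {fst p}" "open_cols (h @ [p]) = open_cols h - {snd p}"
    using assms(2) by (auto simp: open_rows_eq open_cols_eq)
  then show "open_rows (h @ [p]) = {fst q}" and "open_cols (h @ [p]) = {snd q}"
    using assms(1) by (auto simp: outcome_def)
qed

section \<open>The bijection given by a matching that misses one row and one column\<close>

lemma induced_bijection_open:
  assumes "induced_bijection g b d \<sigma>"
  shows "open_rows g = {b}" and "open_cols g = {d}"
proof -
  have bd: "b \<in> R" "d \<in> C" and bij: "\<sigma> ` (R - {b}) = C - {d}"
    and X: "X_stones g = (\<lambda>i. (i, \<sigma> i)) ` (R - {b})"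
    using assms by (auto simp: induced_bijection_def bij_betw_def)
  have "fst ` X_stones g = R - {b}" "snd ` X_stones g = C - {d}"
    unfolding X image_image fst_conv snd_conv using bij by simp_all
  then show "open_rows g = {b}" and "open_cols g = {d}"
    unfolding open_rows_eq open_cols_eq using bd by auto
qed

lemma induced_bijection_exists:
  assumes "matching (X_stones g)" "X_stones g \<subseteq> R \<times> C"
    and "open_rows g = {b}" "open_cols g = {d}"
  shows "\<exists>\<sigma>. induced_bijection g b d \<sigma>"
proof -
  let ?M = "X_stones g"
  have sub: "fst ` ?M \<subseteq> R" "snd ` ?M \<subseteq> C" using assms(2) by auto
  note rows = Diff_eq_singletonD[OF assms(3)[unfolded open_rows_eq] sub(1)]
  note cols = Diff_eq_singletonD[OF assms(4)[unfolded open_cols_eq] sub(2)]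
  have "\<forall>i\<in>R - {b}. \<exists>j. (i, j) \<in> ?M"
  proof
    fix i assume "i \<in> R - {b}"
    then have "i \<in> fst ` ?M" by (simp only: rows)
    then show "\<exists>j. (i, j) \<in> ?M" by force
  qed
  then obtain \<sigma> where \<sigma>: "\<And>i. i \<in> R - {b} \<Longrightarrow> (i, \<sigma> i) \<in> ?M"
    by (metis bchoice)
  have "?M \<subseteq> (\<lambda>i. (i, \<sigma> i)) ` (R - {b})"
  proof
    fix x assume x: "x \<in> ?M"
    then have i: "fst x \<in> R - {b}" using rows by blast
    have "x = (fst x, \<sigma> (fst x))"
      using assms(1) x \<sigma>[OF i] unfolding matching_def by (metis fst_conv)
    then show "x \<in> (\<lambda>i. (i, \<sigma> i)) ` (R - {b})" using i by (rule image_eqI)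
  qed
  then have M: "?M = (\<lambda>i. (i, \<sigma> i)) ` (R - {b})" using \<sigma> by blast
  have "inj_on \<sigma> (R - {b})"
  proof (rule inj_onI)
    fix i j assume ij: "i \<in> R - {b}" "j \<in> R - {b}" "\<sigma> i = \<sigma> j"
    show "i = j"
      using assms(1) \<sigma>[OF ij(1)] \<sigma>[OF ij(2)] ij(3)
      unfolding matching_def by (metis fst_conv snd_conv)
  qed
  moreover have "\<sigma> ` (R - {b}) = C - {d}"
    using cols(1) unfolding M image_image snd_conv .
  ultimately show ?thesis
    using M rows(2) cols(2) unfolding induced_bijection_def bij_betw_def
    by (intro exI[of _ \<sigma>]) (auto simp: image_def)
qed

end

section \<open>Phase 2\<close>

text \<open>Describes the position \<open>h\<close> just before X's move \<open>n - 1\<close>, X's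
  cell \<open>p\<close> and its outcome \<open>q\<close>. The preference for positive weight
  survives only as \<open>tie_break\<close>, the form in which it is used when \<open>F\<close>
  misses the cross of \<open>q\<close>.\<close>

locale decided_game = large_transversal_game R C n
  for R :: "'r set" and C :: "'c set" and n :: nat +
  fixes h :: "('r, 'c) cell list" and p q :: "('r, 'c) cell"
  assumes phase1: "phase1_inv h" and len: "length h = 2 * n - 4"
    and admissible: "admissible_outcome h p q"
    and light: "weight (O_stones h) q \<le> n - 3"
    and tie_break: "\<And>p' q'. \<lbrakk>weight (O_stones h) q = 0; admissible_outcome h p' q';
      weight (O_stones h) q' \<le> n - 3\<rbrakk> \<Longrightarrow> weight (O_stones h) q' = 0"
begin

abbreviation g :: "('r, 'c) cell list" where "g \<equiv> h @ [p]"
abbreviation F :: "('r, 'c) cell set" where "F \<equiv> O_stones h"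
abbreviation M :: "('r, 'c) cell set" where "M \<equiv> X_stones g"
abbreviation b :: 'r where "b \<equiv> fst q"
abbreviation d :: 'c where "d \<equiv> snd q"

lemma even_len: "even (length h)"
  using len by simp

lemma outcome: "outcome h p q"
  and p_free: "p \<in> free h" and q_free: "q \<in> free h"
  using admissible by (auto simp: admissible_outcome_def)

lemma corners_distinct: "fst p \<noteq> b" "snd p \<noteq> d"
  using outcome by (auto simp: outcome_def)

lemma distinct_g: "distinct g" and g_board: "set g \<subseteq> R \<times> C"
  using phase1 p_free by (auto simp: phase1_inv_def free_eq)

lemma O_stones_g: "O_stones g = F"
  using even_len by simp

lemma F_board: "F \<subseteq> R \<times> C" and M_board: "M \<subseteq> R \<times> C"
  using g_board O_stones_subset[of g] X_stones_subset[of g] O_stones_g by blast+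

lemma card_F: "card F = n - 2"
  using card_stones(2)[of h] phase1 len by (auto simp: phase1_inv_def)

lemma p_in_M: "p \<in> M"
  using even_len by simp

lemma free_g: "x \<in> free g \<longleftrightarrow> x \<in> R \<times> C \<and> x \<notin> M \<and> x \<notin> F"
  unfolding free_def O_stones_g by blast

lemma b_row: "b \<in> R" and d_col: "d \<in> C"
  using q_free by (auto simp: free_def)

lemma q_free_g: "q \<in> free g"
  using q_free corners_distinct unfolding free_eq by auto

lemma matching_M: "matching M"
  using matching_insert_open[of h p] outcome_open[OF outcome] phase1 even_len
  by (simp add: phase1_inv_def)

text \<open>
  X plays \<open>c1\<close>, O is forced to \<open>y\<close>, X plays \<open>c2\<close> and then threatens both \<open>z\<close> and \<open>w\<close>.
\<close>

definition winning_plan ::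
    "('r, 'c) cell \<Rightarrow> ('r, 'c) cell \<Rightarrow> ('r, 'c) cell \<Rightarrow> ('r, 'c) cell \<Rightarrow> ('r, 'c) cell \<Rightarrow> bool" where
  "winning_plan c1 y c2 z w \<longleftrightarrow>
     {c1, y, c2, z, w} \<subseteq> free g \<and> distinct [q, c1, y, c2, z, w] \<and>
     \<nu> (insert y (insert c1 M)) = n \<and>
     \<nu> (insert z (insert c2 (insert c1 M))) = n \<and>
     \<nu> (insert w (insert c2 (insert c1 M))) = n \<and>
     (\<forall>x. x \<in> R \<times> C \<longrightarrow> x \<notin> M \<longrightarrow> \<nu> (insert x (insert y (insert q F))) < n)"

lemma winning_planD:
  assumes "winning_plan c1 y c2 z w"
  shows "{c1, y, c2, z, w} \<subseteq> free g" and "distinct [q, c1, y, c2, z, w]"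
    and "\<nu> (insert y (insert c1 M)) = n"
    and "\<nu> (insert z (insert c2 (insert c1 M))) = n"
    and "\<nu> (insert w (insert c2 (insert c1 M))) = n"
    and "x \<in> R \<times> C \<Longrightarrow> x \<notin> M \<Longrightarrow> \<nu> (insert x (insert y (insert q F))) < n"
  using assms unfolding winning_plan_def by blast+

lemma induced_bijection_g: "\<exists>\<sigma>. induced_bijection g b d \<sigma>"
  using induced_bijection_exists[OF matching_M M_board]
    open_after_outcome[OF outcome even_len] by simp

text \<open>The existential in \<open>X_moves\<close> ranges over the missing row and column; the
  position leaves only the outcome \<open>q\<close> for them.\<close>

lemma induced_bijection_unique:
  assumes "induced_bijection g b' d' \<sigma>"
  shows "b' = b" and "d' = d"
  using induced_bijection_open[OF assms] open_after_outcome[OF outcome even_len] by simp_all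

end

locale phase2 = decided_game R C n h p q
  for R :: "'r set" and C :: "'c set" and n :: nat
    and h :: "('r, 'c) cell list" and p q :: "('r, 'c) cell" +
  fixes \<sigma> :: "'r \<Rightarrow> 'c"
  assumes induced: "induced_bijection g b d \<sigma>"
begin

section \<open>Live rows and the existence of an admissible pair\<close>

lemma M_iff: "(i, j) \<in> M \<longleftrightarrow> i \<in> R - {b} \<and> j = \<sigma> i"
  using induced unfolding induced_bijection_def by blast

lemma sigma_inj: "inj_on \<sigma> (R - {b})" and sigma_image: "\<sigma> ` (R - {b}) = C - {d}"
  using induced by (auto simp: induced_bijection_def bij_betw_def)

lemma sigma_col: "i \<in> R \<Longrightarrow> i \<noteq> b \<Longrightarrow> \<sigma> i \<in> C \<and> \<sigma> i \<noteq> d \<and> d \<noteq> \<sigma> i"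
  using sigma_image by blast

lemma sigma_eq_iff: "i \<in> R \<Longrightarrow> i \<noteq> b \<Longrightarrow> j \<in> R \<Longrightarrow> j \<noteq> b \<Longrightarrow> \<sigma> i = \<sigma> j \<longleftrightarrow> i = j"
  using sigma_inj by (auto simp: inj_on_def)

abbreviation live_row :: "'r \<Rightarrow> bool" where "live_row \<equiv> live g b d \<sigma>"

lemma live_iff: "live_row s \<longleftrightarrow> s \<in> R \<and> s \<noteq> b \<and> (s, d) \<notin> F \<and> (b, \<sigma> s) \<notin> F"
  using sigma_col[of s] b_row d_col unfolding live_def free_g M_iff by auto

lemma finite_live: "finite (Collect live_row)"
  by (rule finite_subset[OF _ finite_R]) (auto simp: live_iff)

text \<open>Each stone on the cross of \<open>q\<close> kills at most one row:
  \<open>?\<phi>\<close> sends a stone of column \<open>d\<close> to its row and one of row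
  \<open>b\<close> to the row that \<sigma> matches with its column. Every dead row is in the
  image.\<close>

lemma card_live: "n - 1 \<le> card (Collect live_row) + weight F q"
proof -
  let ?W = "{f \<in> F. fst f = b \<or> snd f = d}"
  let ?\<phi> = "\<lambda>f. if snd f = d then fst f else inv_into (R - {b}) \<sigma> (snd f)"
  have "R - {b} \<subseteq> Collect live_row \<union> ?\<phi> ` ?W"
  proof
    fix s assume s: "s \<in> R - {b}"
    then have inv: "inv_into (R - {b}) \<sigma> (\<sigma> s) = s" by (rule inv_into_f_f[OF sigma_inj])
    consider "live_row s" | "(s, d) \<in> F" | "(b, \<sigma> s) \<in> F" using s live_iff by auto
    then show "s \<in> Collect live_row \<union> ?\<phi> ` ?W"
    proof cases
      case 2
      then have "s = ?\<phi> (s, d)" "(s, d) \<in> ?W" by simp_all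
      then show ?thesis by blast
    next
      case 3
      then have "s = ?\<phi> (b, \<sigma> s)" "(b, \<sigma> s) \<in> ?W" using inv s sigma_col[of s] by simp_all
      then show ?thesis by blast
    qed simp
  qed
  then have "card (R - {b}) \<le> card (Collect live_row \<union> ?\<phi> ` ?W)"
    using finite_live by (intro card_mono) simp_all
  also have "\<dots> \<le> card (Collect live_row) + card (?\<phi> ` ?W)" by (rule card_Un_le)
  also have "card (?\<phi> ` ?W) \<le> card ?W" by (rule card_image_le) simp
  finally show ?thesis using b_row card_R by (simp add: weight_def)
qed

lemma two_live: "card (Collect live_row) \<ge> 2"
  using card_live light n_ge_4 by linarith

lemma other_live: "\<exists>s. live_row s \<and> s \<noteq> x"
proof -
  have "\<not> Collect live_row \<subseteq> {x}" using two_live card_mono[of "{x}" "Collect live_row"] by auto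
  then show ?thesis by blast
qed

text \<open>Cross cells avoid row \<open>b\<close> and column \<open>d\<close>, so only the
  \<open>n - 2 - w\<close> stones off the cross of \<open>q\<close> can occupy them, where
  \<open>w\<close> is the weight of \<open>q\<close>. There are at least \<open>n - 1 - w\<close>
  live rows, and \<open>?K\<close> collects one cross cell per live row: those in the column of
  \<open>s0\<close>, and one further cell in row \<open>s0\<close>. Hence some cell of
  \<open>?K\<close> is free.\<close>

lemma admissible_pair:
  obtains r s where "live_row r" "live_row s" "r \<noteq> s" "(r, \<sigma> s) \<in> free g"
proof -
  let ?L = "Collect live_row"
  let ?W = "{f \<in> F. fst f = b \<or> snd f = d}"
  obtain s0 where s0: "live_row s0" using other_live by blast
  obtain r1 where r1: "live_row r1" "r1 \<noteq> s0" using other_live by blast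
  let ?K = "insert (s0, \<sigma> r1) ((\<lambda>r. (r, \<sigma> s0)) ` (?L - {s0}))"
  have "card ((\<lambda>r. (r, \<sigma> s0)) ` (?L - {s0})) = card ?L - 1"
    using s0 finite_live by (simp add: card_image inj_on_def)
  moreover have "(s0, \<sigma> r1) \<notin> (\<lambda>r. (r, \<sigma> s0)) ` (?L - {s0})" by blast
  ultimately have K: "card ?K = card ?L" using finite_live two_live by simp
  have "card (F - ?W) = card F - card ?W" by (rule card_Diff_subset) auto
  also have "\<dots> < card ?L"
    using card_live two_live light n_ge_4 unfolding card_F weight_def by linarith
  finally have "\<not> ?K \<subseteq> F - ?W" using K card_mono[of "F - ?W" ?K] by auto
  then obtain r s where rs: "live_row r" "live_row s" "r \<noteq> s" "(r, \<sigma> s) \<notin> F - ?W"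
    using s0 r1 by blast
  then have "(r, \<sigma> s) \<in> free g"
    using sigma_col[of s] sigma_eq_iff[of r s] unfolding free_g M_iff live_iff by auto
  with rs that show thesis by blast
qed

lemma weight_zero_iff: "weight F x = 0 \<longleftrightarrow> (\<forall>f\<in>F. fst f \<noteq> fst x \<and> snd f \<noteq> snd x)"
  by (auto simp: weight_def)

lemma fst_p: "fst p \<in> R" "fst p \<noteq> b" and snd_p: "snd p = \<sigma> (fst p)"
  using p_in_M M_iff[of "fst p" "snd p"] by simp_all

lemma plan_choice_exists: "\<exists>P r s. plan_choice g b d \<sigma> P r s"
proof -
  obtain r s where rs: "live_row r" "live_row s" "r \<noteq> s" "(r, \<sigma> s) \<in> free g"
    by (rule admissible_pair)
  consider "\<exists>f\<in>F. snd f = d" | "\<not> (\<exists>f\<in>F. snd f = d)" "\<exists>f\<in>F. fst f = b"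
    | "\<not> (\<exists>f\<in>F. snd f = d)" "\<not> (\<exists>f\<in>F. fst f = b)" "\<nu> F \<le> n - 3"
    | "\<not> (\<exists>f\<in>F. snd f = d)" "\<not> (\<exists>f\<in>F. fst f = b)" "\<not> \<nu> F \<le> n - 3" by blast
  then show ?thesis
  proof cases
    case 1
    then have "plan_choice g b d \<sigma> Plan_i r s"
      unfolding plan_choice_def Let_def O_stones_g using rs by simp
    then show ?thesis by blast
  next
    case 2
    \<comment> \<open>The cross cell of plan (ii) has the two rows exchanged, so the same admissible
      pair is used in reverse order.\<close>
    then have "plan_choice g b d \<sigma> Plan_ii s r"
      unfolding plan_choice_def Let_def O_stones_g using rs by simp
    then show ?thesis by blast
  next
    case 3
    then have "plan_choice g b d \<sigma> Plan_i r s"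
      unfolding plan_choice_def Let_def O_stones_g using rs by simp
    then show ?thesis by blast
  next
    case 4
    have "\<nu> F \<le> n - 2" using max_matching_le_card[of F] card_F by simp
    with 4 have nu: "\<nu> F = n - 2" by linarith
    \<comment> \<open>As \<open>F\<close> misses the cross of \<open>q\<close>, all rows other than
      \<open>b\<close> are live, in particular that of the tie-break stone.\<close>
    have live: "live_row (fst p)" using 4 fst_p unfolding live_iff by force
    obtain r' where "live_row r'" "r' \<noteq> fst p" using other_live by blast
    then have "plan_choice g b d \<sigma> Plan_i r' (fst p)"
      unfolding plan_choice_def Let_def O_stones_g using 4 live nu by simp
    then show ?thesis by blast
  qed
qed

section \<open>Transversals obtained by rerouting X's matching\<close>

lemma direct_win:
  assumes "S \<subseteq> R \<times> C" "M \<subseteq> S" "q \<in> S"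
  shows "\<nu> S = n"
proof (rule max_matching_transversal[OF assms(1), of "\<sigma>(b := d)"])
  show "inj_on (\<sigma>(b := d)) R" using sigma_eq_iff sigma_col by (auto simp: inj_on_def)
  show "(i, (\<sigma>(b := d)) i) \<in> S" if "i \<in> R" for i
    using that assms(2,3) M_iff[of i "\<sigma> i"] by (cases "i = b") auto
qed

text \<open>Row \<open>b\<close> takes over the column of row \<open>r\<close>, and row
  \<open>r\<close> moves to column \<open>d\<close>; one stone of \<open>M\<close> is
  dropped.\<close>

lemma single_detour:
  assumes "S \<subseteq> R \<times> C" "M \<subseteq> S" "r \<in> R" "r \<noteq> b" "(b, \<sigma> r) \<in> S" "(r, d) \<in> S"
  shows "\<nu> S = n"
proof (rule max_matching_transversal[OF assms(1), of "\<sigma>(b := \<sigma> r, r := d)"])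
  show "inj_on (\<sigma>(b := \<sigma> r, r := d)) R"
    using sigma_eq_iff sigma_col assms(3,4) by (auto simp: inj_on_def)
  show "(i, (\<sigma>(b := \<sigma> r, r := d)) i) \<in> S" if "i \<in> R" for i
    using that assms M_iff[of i "\<sigma> i"] by auto
qed

text \<open>The chain \<open>b\<close> to \<open>\<sigma> r\<close>, \<open>r\<close> to
  \<open>\<sigma> s\<close>, \<open>s\<close> to \<open>d\<close> drops two stones of
  \<open>M\<close> and passes through the cross cell.\<close>

lemma double_detour:
  assumes "S \<subseteq> R \<times> C" "M \<subseteq> S" "r \<in> R" "r \<noteq> b" "s \<in> R" "s \<noteq> b" "r \<noteq> s"
    and "(b, \<sigma> r) \<in> S" "(s, d) \<in> S" "(r, \<sigma> s) \<in> S"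
  shows "\<nu> S = n"
proof (rule max_matching_transversal[OF assms(1), of "\<sigma>(b := \<sigma> r, s := d, r := \<sigma> s)"])
  show "inj_on (\<sigma>(b := \<sigma> r, s := d, r := \<sigma> s)) R"
    using sigma_eq_iff sigma_col assms(3-7) by (auto simp: inj_on_def)
  show "(i, (\<sigma>(b := \<sigma> r, s := d, r := \<sigma> s)) i) \<in> S" if "i \<in> R" for i
    using that assms M_iff[of i "\<sigma> i"] by auto
qed

text \<open>\<open>A\<close> contributes at most \<open>n - 3\<close>, the line \<open>L\<close> at
  most 1 and \<open>x\<close> at most 1, in total \<open>n - 1\<close>. Here \<open>A\<close> will
  be \<open>F\<close>, or \<open>F\<close> without a stone that already lies on the line.\<close>

lemma O_safe_if_small:
  assumes "finite L" "(\<forall>p\<in>L. fst p = i) \<or> (\<forall>p\<in>L. snd p = j)" "\<nu> A \<le> n - 3" "finite A"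
    and "F \<union> {q, y} \<subseteq> A \<union> L"
  shows "\<nu> (insert x (insert y (insert q F))) < n"
proof -
  have "\<nu> (insert x (insert y (insert q F))) \<le> \<nu> (insert x (A \<union> L))"
    using assms by (intro max_matching_mono) auto
  also have "\<dots> \<le> \<nu> (A \<union> L) + 1" using assms by (intro max_matching_insert) auto
  also have "\<nu> (A \<union> L) \<le> \<nu> A + 1" using assms by (intro max_matching_Un_line)
  finally show ?thesis using assms(3) n_ge_4 by linarith
qed

text \<open>
  If no stone of \<open>F\<close> lies on the missing row or column, the corners \<open>(fst p, d)\<close> and
  \<open>(b, snd p)\<close> of the last open block are free as well, so the tie-break would have preferred
  any outcome of weight 1 among the remaining three corners.
\<close>

lemma F_avoids_open_block:
  assumes "\<forall>f\<in>F. fst f \<noteq> b \<and> snd f \<noteq> d" "\<nu> F = n - 2" "f \<in> F"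
  shows "fst f \<noteq> fst p" and "snd f \<noteq> snd p"
proof -
  obtain T where T: "T \<subseteq> F" "matching T" "card T = \<nu> F"
    using max_matching_attained[OF finite_stones(2)] by blast
  \<comment> \<open>A matching of size \<open>n - 2\<close> inside the \<open>n - 2\<close> stones
    of \<open>F\<close> is all of \<open>F\<close>.\<close>
  have "T = F" using T(1,3) assms(2) card_F by (intro card_subset_eq) simp_all
  with T have mF: "matching F" by simp
  have w0: "weight F q = 0" using assms(1) by (simp add: weight_zero_iff)
  have inF: "x \<in> free h" if "x \<in> open_block h" "x \<notin> F" for x
    using that by (rule open_block_free)
  have blk: "open_block h = {p, q, (fst p, d), (b, snd p)}"
    by (rule outcome_open[OF outcome])
  have c1: "(fst p, d) \<in> free h" "(b, snd p) \<in> free h"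
    using assms(1) by (auto intro!: inF simp: blk)
  have o1: "outcome h (fst p, d) (b, snd p)" "outcome h (b, snd p) (fst p, d)"
    using outcome by (auto simp: outcome_def)
  have adm: "admissible_outcome h (b, snd p) (fst p, d)"
    "admissible_outcome h (fst p, d) (b, snd p)"
    using c1 o1 by (auto simp: admissible_outcome_def)
  \<comment> \<open>Since \<open>F\<close> avoids row \<open>b\<close> and column \<open>d\<close>,
    each of these crosses meets \<open>F\<close> in a single line only, and there at most once
    because \<open>F\<close> is a matching. As \<open>1 \<le> n - 3\<close>, both outcomes are light
    and \<open>tie_break\<close> reduces their weights to 0.\<close>
  have one: "weight F (fst p, d) \<le> 1" "weight F (b, snd p) \<le> 1"
  proof -
    let ?A = "{f \<in> F. fst f = fst p \<or> snd f = d}" and ?B = "{f \<in> F. fst f = b \<or> snd f = snd p}"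
    have fin: "finite ?A" "finite ?B" by simp_all
    have eq: "\<forall>x\<in>?A. \<forall>y\<in>?A. x = y" "\<forall>x\<in>?B. \<forall>y\<in>?B. x = y"
      using assms(1) mF unfolding matching_def by (metis (mono_tags, lifting) mem_Collect_eq)+
    show "weight F (fst p, d) \<le> 1" "weight F (b, snd p) \<le> 1"
      unfolding weight_def fst_conv snd_conv One_nat_def
      using iffD2[OF card_le_Suc0_iff_eq[OF fin(1)] eq(1)]
        iffD2[OF card_le_Suc0_iff_eq[OF fin(2)] eq(2)] .
  qed
  have "weight F (fst p, d) = 0" "weight F (b, snd p) = 0"
    using tie_break[OF w0 adm(1)] tie_break[OF w0 adm(2)] one n_ge_4 by auto
  then show "fst f \<noteq> fst p" and "snd f \<noteq> snd p"
    unfolding weight_zero_iff using assms(3) by simp_all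
qed

text \<open>A transversal meets the row and the column of \<open>p\<close>. None of
  \<open>F\<close>, \<open>q\<close> and \<open>y\<close> meets either, so \<open>x\<close> would
  have to meet both and be \<open>p\<close> itself, a stone of X.\<close>

lemma O_safe_if_covered:
  assumes "\<forall>f\<in>F. fst f \<noteq> fst p \<and> snd f \<noteq> snd p"
    and "fst y \<noteq> fst p" "snd y \<noteq> snd p" "y \<in> R \<times> C" "x \<in> R \<times> C" "x \<notin> M"
  shows "\<nu> (insert x (insert y (insert q F))) < n"
proof -
  let ?S = "insert x (insert y (insert q F))"
  have S: "?S \<subseteq> R \<times> C" using F_board b_row d_col assms(4,5) by (cases q) auto
  have "\<nu> ?S \<noteq> n"
  proof
    assume nu: "\<nu> ?S = n"
    have "finite ?S" by simp
    then obtain T where T: "T \<subseteq> ?S" "matching T" "card T = n"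
      using max_matching_attained nu by metis
    have "fst ` T = R" "snd ` T = C" using transversal_covers[of T] T S by auto
    moreover have "fst p \<in> R" "snd p \<in> C" using p_in_M M_board mem_Times_iff by blast+
    ultimately have "fst p \<in> fst ` T" "snd p \<in> snd ` T" by simp_all
    then have "fst p \<in> fst ` ?S" "snd p \<in> snd ` ?S" using T(1) by (meson image_mono subsetD)+
    moreover have "fst p \<notin> fst ` F" "snd p \<notin> snd ` F" using assms(1) by auto
    ultimately have "fst x = fst p" "snd x = snd p"
      using assms(2,3) corners_distinct by simp_all
    then have "x = p" by (rule prod_eqI)
    then show False using p_in_M assms(6) by simp
  qed
  then show ?thesis using max_matching_board_le[OF S] by linarith
qed

text \<open>The first plan cell threatens the single detour through \<open>r\<close>, which forces O
  to \<open>(r, d)\<close>. The second adds two threats: the single detour through \<open>s\<close>,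
  and the double detour through the cross cell.\<close>

lemma winning_plan_i:
  assumes rs: "live_row r" "live_row s" "r \<noteq> s" and cross: "(r, \<sigma> s) \<in> free g"
    and safe: "\<And>x. x \<in> R \<times> C \<Longrightarrow> x \<notin> M \<Longrightarrow> \<nu> (insert x (insert (r, d) (insert q F))) < n"
  shows "winning_plan (b, \<sigma> r) (r, d) (s, d) (b, \<sigma> s) (r, \<sigma> s)"
proof -
  have r: "r \<in> R" "r \<noteq> b" and s: "s \<in> R" "s \<noteq> b" using rs by (auto simp: live_iff)
  have fr: "{(b, \<sigma> r), (r, d), (s, d), (b, \<sigma> s), (r, \<sigma> s)} \<subseteq> free g"
    using rs cross unfolding live_def by simp
  then have board: "{(b, \<sigma> r), (r, d), (s, d), (b, \<sigma> s), (r, \<sigma> s)} \<union> M \<subseteq> R \<times> C"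
    using M_board by (auto simp: free_def)
  have "distinct [q, (b, \<sigma> r), (r, d), (s, d), (b, \<sigma> s), (r, \<sigma> s)]"
    using r s rs(3) sigma_col sigma_eq_iff by (cases q) auto
  moreover have "\<nu> (insert (r, d) (insert (b, \<sigma> r) M)) = n"
    using board r by (intro single_detour[of _ r]) auto
  moreover have "\<nu> (insert (b, \<sigma> s) (insert (s, d) (insert (b, \<sigma> r) M))) = n"
    using board s by (intro single_detour[of _ s]) auto
  moreover have "\<nu> (insert (r, \<sigma> s) (insert (s, d) (insert (b, \<sigma> r) M))) = n"
    using board r s rs(3) by (intro double_detour[of _ r s]) auto
  ultimately show ?thesis using fr safe unfolding winning_plan_def by blast
qed

text \<open>Mirror image of plan (i) with the missing row and column exchanged; the double detour
  runs through the pair in reverse order.\<close>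

lemma winning_plan_ii:
  assumes rs: "live_row r" "live_row s" "r \<noteq> s" and cross: "(s, \<sigma> r) \<in> free g"
    and safe: "\<And>x. x \<in> R \<times> C \<Longrightarrow> x \<notin> M \<Longrightarrow> \<nu> (insert x (insert (b, \<sigma> r) (insert q F))) < n"
  shows "winning_plan (r, d) (b, \<sigma> r) (b, \<sigma> s) (s, d) (s, \<sigma> r)"
proof -
  have r: "r \<in> R" "r \<noteq> b" and s: "s \<in> R" "s \<noteq> b" using rs by (auto simp: live_iff)
  have fr: "{(r, d), (b, \<sigma> r), (b, \<sigma> s), (s, d), (s, \<sigma> r)} \<subseteq> free g"
    using rs cross unfolding live_def by simp
  then have board: "{(r, d), (b, \<sigma> r), (b, \<sigma> s), (s, d), (s, \<sigma> r)} \<union> M \<subseteq> R \<times> C"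
    using M_board by (auto simp: free_def)
  have "distinct [q, (r, d), (b, \<sigma> r), (b, \<sigma> s), (s, d), (s, \<sigma> r)]"
    using r s rs(3) sigma_col sigma_eq_iff by (cases q) auto
  moreover have "\<nu> (insert (b, \<sigma> r) (insert (r, d) M)) = n"
    using board r by (intro single_detour[of _ r]) auto
  moreover have "\<nu> (insert (s, d) (insert (b, \<sigma> s) (insert (r, d) M))) = n"
    using board s by (intro single_detour[of _ s]) auto
  moreover have "\<nu> (insert (s, \<sigma> r) (insert (b, \<sigma> s) (insert (r, d) M))) = n"
    using board r s rs(3) by (intro double_detour[of _ s r]) auto
  ultimately show ?thesis using fr safe unfolding winning_plan_def by blast
qed

text \<open>O's forced stones share column \<open>d\<close> in plan (i) and row \<open>b\<close> in
  plan (ii). The plan is chosen so that a stone of \<open>F\<close> on the cross, if there is one,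
  lies in that same line; otherwise a small \<nu> or the tie-break makes up for it.\<close>

lemma plan_choice_wins:
  assumes choice: "plan_choice g b d \<sigma> P r s" and cells: "plan_cells b d \<sigma> P r s = (c1, c2)"
  shows "\<exists>y z w. winning_plan c1 y c2 z w"
proof -
  have rs: "live_row r" "live_row s" "r \<noteq> s" using choice unfolding plan_choice_def by auto
  have rest: "\<nu> (F - {f}) \<le> n - 3" if "f \<in> F" for f
    using max_matching_le_card[of "F - {f}"] that card_F by simp
  consider (col) f where "f \<in> F" "snd f = d" "P = Plan_i" "(r, \<sigma> s) \<in> free g"
    | (row) f where "f \<in> F" "fst f = b" "P = Plan_ii" "(s, \<sigma> r) \<in> free g"
    | (small) "\<nu> F \<le> n - 3" "P = Plan_i" "(r, \<sigma> s) \<in> free g"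
    | (large) "\<forall>f\<in>F. fst f \<noteq> b \<and> snd f \<noteq> d" "\<nu> F = n - 2" "P = Plan_i" "s = fst p"
  proof (cases "\<exists>f\<in>F. snd f = d")
    case True
    then show thesis using choice col unfolding plan_choice_def Let_def O_stones_g by auto
  next
    case F1: False
    show thesis
    proof (cases "\<exists>f\<in>F. fst f = b")
      case True
      then show thesis using choice F1 row unfolding plan_choice_def Let_def O_stones_g by auto
    next
      case False
      then show thesis
        using choice F1 small large unfolding plan_choice_def Let_def O_stones_g
        by (auto split: if_splits)
    qed
  qed
  then show ?thesis
  proof cases
    case col
    have "winning_plan (b, \<sigma> r) (r, d) (s, d) (b, \<sigma> s) (r, \<sigma> s)"
    proof (rule winning_plan_i[OF rs col(4)])
      show "\<nu> (insert x (insert (r, d) (insert q F))) < n" for x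
        using col rest by (intro O_safe_if_small[of "{f, q, (r, d)}" _ d "F - {f}"]) auto
    qed
    moreover have "c1 = (b, \<sigma> r)" "c2 = (s, d)" using cells col by auto
    ultimately show ?thesis by blast
  next
    case row
    have "winning_plan (r, d) (b, \<sigma> r) (b, \<sigma> s) (s, d) (s, \<sigma> r)"
    proof (rule winning_plan_ii[OF rs row(4)])
      show "\<nu> (insert x (insert (b, \<sigma> r) (insert q F))) < n" for x
        using row rest by (intro O_safe_if_small[of "{f, q, (b, \<sigma> r)}" b _ "F - {f}"]) auto
    qed
    moreover have "c1 = (r, d)" "c2 = (b, \<sigma> s)" using cells row by auto
    ultimately show ?thesis by blast
  next
    case small
    have "winning_plan (b, \<sigma> r) (r, d) (s, d) (b, \<sigma> s) (r, \<sigma> s)"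
    proof (rule winning_plan_i[OF rs small(3)])
      show "\<nu> (insert x (insert (r, d) (insert q F))) < n" for x
        using small by (intro O_safe_if_small[of "{q, (r, d)}" _ d F]) auto
    qed
    moreover have "c1 = (b, \<sigma> r)" "c2 = (s, d)" using cells small by auto
    ultimately show ?thesis by blast
  next
    case large
    note avoid = F_avoids_open_block[OF large(1,2)]
    have "r \<in> R" "r \<noteq> b" "r \<noteq> fst p" using rs large(4) by (auto simp: live_iff)
    note r = this
    \<comment> \<open>The rule does not ask for a free cross cell here. It lies in the column of the
      tie-break stone, which \<open>F\<close> avoids.\<close>
    have "(r, snd p) \<notin> F" using avoid(2) by force
    then have cross: "(r, \<sigma> s) \<in> free g"
      using r fst_p sigma_col[of "fst p"] sigma_eq_iff[of r "fst p"] large(4)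
      unfolding free_g M_iff snd_p by auto
    have "winning_plan (b, \<sigma> r) (r, d) (s, d) (b, \<sigma> s) (r, \<sigma> s)"
    proof (rule winning_plan_i[OF rs cross])
      show "\<nu> (insert x (insert (r, d) (insert q F))) < n" if "x \<in> R \<times> C" "x \<notin> M" for x
        using that avoid r d_col corners_distinct by (intro O_safe_if_covered) auto
    qed
    moreover have "c1 = (b, \<sigma> r)" "c2 = (s, d)" using cells large by auto
    ultimately show ?thesis by blast
  qed
qed

end

section \<open>Following the play\<close>

context decided_game
begin

definition planned :: "('r, 'c) cell \<Rightarrow> ('r, 'c) cell \<Rightarrow> bool" where
  "planned c1 c2 \<longleftrightarrow> (\<exists>b d \<sigma> P r s. induced_bijection g b d \<sigma> \<and>
     plan_choice g b d \<sigma> P r s \<and> (c1, c2) = plan_cells b d \<sigma> P r s)"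

lemma phase2I: "induced_bijection g b d \<sigma> \<Longrightarrow> phase2 R C n h p q \<sigma>"
  by (intro phase2.intro decided_game_axioms phase2_axioms.intro)

lemma q_wins:
  assumes "S \<subseteq> R \<times> C" "M \<subseteq> S" "q \<in> S"
  shows "\<nu> S = n"
proof -
  obtain \<sigma> where "induced_bijection g b d \<sigma>" using induced_bijection_g by blast
  then interpret phase2 R C n h p q \<sigma> by (rule phase2I)
  show ?thesis using assms by (rule direct_win)
qed

lemma planned_exists: "\<exists>c1 c2. planned c1 c2"
proof -
  obtain \<sigma> where \<sigma>: "induced_bijection g b d \<sigma>" using induced_bijection_g by blast
  then interpret phase2 R C n h p q \<sigma> by (rule phase2I)
  obtain P r s where "plan_choice g b d \<sigma> P r s" using plan_choice_exists by blast
  with \<sigma> show ?thesis unfolding planned_def by (metis surj_pair)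
qed

lemma planned_wins:
  assumes "planned c1 c2"
  shows "\<exists>y z w. winning_plan c1 y c2 z w"
proof -
  obtain b' d' \<sigma> P r s where *: "induced_bijection g b' d' \<sigma>" "plan_choice g b' d' \<sigma> P r s"
    "(c1, c2) = plan_cells b' d' \<sigma> P r s"
    using assms unfolding planned_def by blast
  note bd = induced_bijection_unique[OF *(1)]
  interpret phase2 R C n h p q \<sigma> using *(1) unfolding bd by (rule phase2I)
  show ?thesis using *(2,3) unfolding bd by (intro plan_choice_wins[of P r s]) simp_all
qed

lemma M_subset: "M \<subseteq> set g"
  by (rule X_stones_subset)

text \<open>Unless O takes \<open>q\<close>, X completes at \<open>q\<close> at once. So whenever no
  completing cell is left, O has played \<open>q\<close>, and the plan cells are still free because
  they differ from it.\<close>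

lemma first_reply:
  fixes m :: "('r, 'c) cell option"
  defines "h' x \<equiv> h @ [p, x]"
  assumes x: "x \<in> free g"
  shows "X_moves (h' x) m \<noteq> {}"
    and "(c, m') \<in> X_moves (h' x) m \<Longrightarrow> c \<in> free (h' x) \<and>
      (\<nu> (insert c (X_stones (h' x))) = n \<or> (\<exists>c2. x = q \<and> m' = Some c2 \<and> planned c c2))"
proof -
  have half: "length (h' x) div 2 + 1 = n" using len n_ge_4 by (simp add: h'_def)
  have g: "take (2 * n - 3) (h' x) = g" using len n_ge_4 by (simp add: h'_def)
  have X: "X_stones (h' x) = M" using even_len by (simp add: h'_def stones_append)
  have fr: "free (h' x) = free g - {x}" by (auto simp: h'_def free_eq)
  have "X_moves (h' x) m \<noteq> {} \<and> (\<forall>(c, m') \<in> X_moves (h' x) m. c \<in> free (h' x) \<and>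
      (\<nu> (insert c (X_stones (h' x))) = n \<or> (\<exists>c2. x = q \<and> m' = Some c2 \<and> planned c c2)))"
  proof (cases "completing (h' x) = {}")
    case False
    then have "X_moves (h' x) m = {(c, m) | c. c \<in> completing (h' x)}"
      using half n_ge_4 by (intro X_moves_completing) simp_all
    then show ?thesis using False completingD[of _ "h' x"] by auto
  next
    case True
    have "x = q"
    proof (rule ccontr)
      assume "x \<noteq> q"
      then have "q \<in> free (h' x)" using q_free_g fr by simp
      moreover have "\<nu> (insert q (X_stones (h' x))) = n"
        unfolding X using M_board b_row d_col by (intro q_wins) (auto simp: mem_Times_iff)
      ultimately show False using True completingI by blast
    qed
    have moves: "X_moves (h' x) m = {(c1, Some c2) | c1 c2. planned c1 c2}"
    proof -
      have "\<not> n \<le> n - 2" "n \<noteq> n - 1" using n_ge_4 by linarith+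
      then show ?thesis
        unfolding X_moves_def Let_def half g planned_def using True by (simp only: if_False if_True simp_thms)
    qed
    have "c1 \<in> free (h' x)" if plan: "planned c1 c2" for c1 c2
    proof -
      obtain y z w where "winning_plan c1 y c2 z w" using planned_wins[OF plan] by blast
      from winning_planD(1,2)[OF this] show ?thesis unfolding fr using \<open>x = q\<close> by auto
    qed
    then show ?thesis using moves planned_exists \<open>x = q\<close> by auto
  qed
  then show "X_moves (h' x) m \<noteq> {}"
    and "(c, m') \<in> X_moves (h' x) m \<Longrightarrow> c \<in> free (h' x) \<and>
      (\<nu> (insert c (X_stones (h' x))) = n \<or> (\<exists>c2. x = q \<and> m' = Some c2 \<and> planned c c2))"
    by blast+
qed

text \<open>The same argument with the forced cell \<open>y\<close> in place of \<open>q\<close>: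
  without a completing cell O's stone must be \<open>y\<close>, and the remembered cell
  \<open>c2\<close> is free.\<close>

lemma second_reply:
  defines "h' c1 x \<equiv> h @ [p, q, c1, x]"
  assumes plan: "planned c1 c2" and x: "x \<in> free (h @ [p, q, c1])"
  shows "X_moves (h' c1 x) (Some c2) \<noteq> {}"
    and "(c, m') \<in> X_moves (h' c1 x) (Some c2) \<Longrightarrow> c \<in> free (h' c1 x) \<and>
      (\<nu> (insert c (X_stones (h' c1 x))) = n \<or> (\<exists>z w. c = c2 \<and> winning_plan c1 x c2 z w))"
proof -
  let ?h = "h' c1 x"
  obtain y z w where win: "winning_plan c1 y c2 z w" using planned_wins[OF plan] by blast
  have half: "length ?h div 2 + 1 = n + 1" using len n_ge_4 by (simp add: h'_def)
  have X: "X_stones ?h = insert c1 M"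
    using even_len by (simp add: h'_def stones_append insert_commute)
  have fr: "free ?h = free g - {q, c1, x}" by (auto simp: h'_def free_eq)
  have "X_moves ?h (Some c2) \<noteq> {} \<and> (\<forall>(c, m') \<in> X_moves ?h (Some c2). c \<in> free ?h \<and>
      (\<nu> (insert c (X_stones ?h)) = n \<or> (\<exists>z w. c = c2 \<and> winning_plan c1 x c2 z w)))"
  proof (cases "completing ?h = {}")
    case False
    then have "X_moves ?h (Some c2) = {(c, Some c2) | c. c \<in> completing ?h}"
      using half n_ge_4 by (intro X_moves_completing) simp_all
    then show ?thesis using False completingD[of _ ?h] by auto
  next
    case True
    have "x = y"
    proof (rule ccontr)
      assume "x \<noteq> y"
      then have "y \<in> free ?h" using winning_planD(1,2)[OF win] unfolding fr by auto
      moreover have "\<nu> (insert y (X_stones ?h)) = n"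
        unfolding X by (rule winning_planD(3)[OF win])
      ultimately show False using True completingI by blast
    qed
    have moves: "X_moves ?h (Some c2) = {(c2, None)}"
    proof -
      have "\<not> n + 1 \<le> n - 2" "n + 1 \<noteq> n - 1" "n + 1 \<noteq> n" using n_ge_4 by linarith+
      then show ?thesis unfolding X_moves_def Let_def half using True by auto
    qed
    have "c2 \<in> free ?h" 
      unfolding fr using winning_planD(1,2)[OF win] \<open>x = y\<close> by auto
    moreover have "\<exists>z w. winning_plan c1 x c2 z w" using win \<open>x = y\<close> by blast
    ultimately show ?thesis unfolding moves by simp
  qed
  then show "X_moves ?h (Some c2) \<noteq> {}"
    and "(c, m') \<in> X_moves ?h (Some c2) \<Longrightarrow> c \<in> free ?h \<and>
      (\<nu> (insert c (X_stones ?h)) = n \<or> (\<exists>z w. c = c2 \<and> winning_plan c1 x c2 z w))"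
    by blast+
qed

text \<open>One stone \<open>x\<close> cannot block both \<open>z\<close> and
  \<open>w\<close>.\<close>

lemma final_reply:
  defines "h' c1 y c2 x \<equiv> h @ [p, q, c1, y, c2, x]"
  assumes win: "winning_plan c1 y c2 z w"
  shows "X_moves (h' c1 y c2 x) m \<noteq> {}"
    and "(c, m') \<in> X_moves (h' c1 y c2 x) m \<Longrightarrow>
      c \<in> free (h' c1 y c2 x) \<and> \<nu> (insert c (X_stones (h' c1 y c2 x))) = n"
proof -
  let ?h = "h' c1 y c2 x"
  have half: "length ?h div 2 + 1 = n + 2" using len n_ge_4 by (simp add: h'_def)
  have X: "X_stones ?h = insert c2 (insert c1 M)"
    using even_len by (simp add: h'_def stones_append insert_commute)
  have fr: "free ?h = free g - {q, c1, y, c2, x}" by (auto simp: h'_def free_eq)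
  have "z \<in> free ?h \<or> w \<in> free ?h" using winning_planD(1,2)[OF win] unfolding fr by auto
  moreover have "\<nu> (insert z (X_stones ?h)) = n" "\<nu> (insert w (X_stones ?h)) = n"
    unfolding X by (rule winning_planD(4,5)[OF win])+
  ultimately have ne: "completing ?h \<noteq> {}" using completingI by blast
  then have "X_moves ?h m = {(c, m) | c. c \<in> completing ?h}"
    using half n_ge_4 by (intro X_moves_completing) simp_all
  then show "X_moves ?h m \<noteq> {}"
    and "(c, m') \<in> X_moves ?h m \<Longrightarrow> c \<in> free ?h \<and> \<nu> (insert c (X_stones ?h)) = n"
    using ne completingD[of c ?h] by auto
qed

text \<open>O may have ignored the forced cell \<open>y\<close>; adding \<open>y\<close> only
  enlarges O's set, so the bound in the winning plan still applies.\<close>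

lemma O_safe_second:
  assumes "winning_plan c1 y c2 z w" "x \<in> free (h @ [p, q, c1])"
  shows "\<nu> (O_stones (h @ [p, q, c1, x])) < n"
proof -
  have "x \<in> R \<times> C" "x \<notin> set g" using assms(2) by (simp_all add: free_eq)
  then have "x \<in> R \<times> C" "x \<notin> M" using M_subset by blast+
  then have "\<nu> (insert x (insert y (insert q F))) < n"
    by (rule winning_planD(6)[OF assms(1)])
  moreover have "O_stones (h @ [p, q, c1, x]) \<subseteq> insert x (insert y (insert q F))"
    using even_len by (auto simp: stones_append)
  then have "\<nu> (O_stones (h @ [p, q, c1, x])) \<le> \<nu> (insert x (insert y (insert q F)))"
    by (intro max_matching_mono) simp_all
  ultimately show ?thesis by linarith
qed

lemma O_safe_final:
  assumes "winning_plan c1 y c2 z w" "x \<in> free (h @ [p, q, c1, y, c2])"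
  shows "\<nu> (O_stones (h @ [p, q, c1, y, c2, x])) < n"
proof -
  have "x \<in> R \<times> C" "x \<notin> set g" using assms(2) by (simp_all add: free_eq)
  then have "x \<in> R \<times> C" "x \<notin> M" using M_subset by blast+
  then have "\<nu> (insert x (insert y (insert q F))) < n"
    by (rule winning_planD(6)[OF assms(1)])
  moreover have "O_stones (h @ [p, q, c1, y, c2, x]) = insert x (insert y (insert q F))"
    using even_len by (auto simp: stones_append)
  ultimately show ?thesis by simp
qed

end

context large_transversal_game
begin

lemma X_moves_phase1:
  assumes "length h div 2 + 1 \<le> n - 2"
  shows "X_moves h m = {(c, None) | c. c \<in> phase1_cells h}"
  using assms unfolding X_moves_def Let_def by simp

lemma X_moves_tie_break:
  assumes "length h = 2 * n - 4"
  shows "X_moves h m = {(c, None) | c. c \<in> tie_break_cells h}"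
proof -
  have half: "length h div 2 + 1 = n - 1" using assms n_ge_4 by presburger
  have "\<not> n - 1 \<le> n - 2" using n_ge_4 by linarith
  then show ?thesis unfolding X_moves_def Let_def half by simp
qed

section \<open>The shape of every play from ply \<open>2n - 3\<close> on\<close>

lemma play_2n_minus_3:
  assumes "play g m" "length g = 2 * n - 3"
  obtains h p q where "decided_game R C n h p q" "g = h @ [p]"
proof -
  have "length g = Suc (2 * n - 4)" using assms(2) n_ge_4 by simp
  then obtain h p m' where h: "g = h @ [p]" "length h = 2 * n - 4" "play h m'"
    "if even (2 * n - 4) then (p, m) \<in> X_moves h m' else p \<in> free h \<and> m' = m"
    by (rule play_SucD[OF assms(1)])
  then have "p \<in> tie_break_cells h" using X_moves_tie_break[OF h(2)] by auto
  then obtain q where "admissible_outcome h p q" "weight (O_stones h) q \<le> n - 3"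
    "weight (O_stones h) q = 0 \<longrightarrow>
       (\<forall>p' q'. admissible_outcome h p' q' \<longrightarrow> weight (O_stones h) q' \<le> n - 3 \<longrightarrow>
          weight (O_stones h) q' = 0)"
    by (rule tie_break_cellsD)
  moreover have "phase1_inv h" using play_phase1_inv[OF h(3)] h(2) by simp
  ultimately have "decided_game R C n h p q" using h(2) by unfold_locales blast+
  then show thesis using h(1) by (rule that)
qed

lemma play_2n_minus_2:
  assumes "play g m" "length g = 2 * n - 2"
  obtains h p q x where "decided_game R C n h p q" "g = h @ [p, x]" "x \<in> free (h @ [p])"
proof -
  have "length g = Suc (2 * n - 3)" "odd (2 * n - 3)" using assms(2) n_ge_4 by simp_all
  then obtain g' x m' where g: "g = g' @ [x]" "length g' = 2 * n - 3" "play g' m'" "x \<in> free g'"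
    using play_SucD[OF assms(1)] by (metis (full_types))
  obtain h p q where "decided_game R C n h p q" "g' = h @ [p]"
    using play_2n_minus_3[OF g(3,2)] .
  then show thesis using g that[of h p q x] by simp
qed

text \<open>As X has not won, the last move was not a completing cell. It therefore came from the
  plan, which requires that O has just taken \<open>q\<close>.\<close>

lemma play_2n_minus_1:
  assumes "play g m" "length g = 2 * n - 1" "\<nu> (X_stones g) \<noteq> n"
  obtains h p q c1 c2 where "decided_game R C n h p q" "g = h @ [p, q, c1]" "m = Some c2"
    "decided_game.planned R C n h p c1 c2"
proof -
  have "length g = Suc (2 * n - 2)" "even (2 * n - 2)" using assms(2) n_ge_4 by simp_all
  then obtain g' c m' where g: "g = g' @ [c]" "length g' = 2 * n - 2" "play g' m'"
    "(c, m) \<in> X_moves g' m'"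
    using play_SucD[OF assms(1)] by (metis (full_types))
  obtain h p q x where h: "decided_game R C n h p q" "g' = h @ [p, x]" "x \<in> free (h @ [p])"
    using play_2n_minus_2[OF g(3,2)] .
  interpret decided_game R C n h p q by fact
  have "\<nu> (insert c (X_stones g')) \<noteq> n" using assms(3) g(1,2) by simp
  then obtain c2 where "x = q" "m = Some c2" "planned c c2"
    using first_reply(2)[OF h(3), of c m m'] g(4) unfolding h(2) by blast
  then show thesis using h g(1) that by simp
qed

lemma play_2n:
  assumes "play g m" "length g = 2 * n"
  obtains h p q c1 c2 x where "decided_game R C n h p q" "g = h @ [p, q, c1, x]" "m = Some c2"
    "decided_game.planned R C n h p c1 c2" "x \<in> free (h @ [p, q, c1])"
proof -
  have "length g = Suc (2 * n - 1)" "odd (2 * n - 1)" using assms(2) n_ge_4 by simp_all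
  then obtain g' x where g: "g = g' @ [x]" "length g' = 2 * n - 1" "play g' m" "x \<in> free g'"
    "\<not> game_over g'"
    using play_SucD[OF assms(1)] by (metis (full_types))
  have "\<nu> (X_stones g') \<noteq> n" using g(5) by (simp add: game_over_def)
  then obtain h p q c1 c2 where "decided_game R C n h p q" "g' = h @ [p, q, c1]" "m = Some c2"
    "decided_game.planned R C n h p c1 c2"
    by (rule play_2n_minus_1[OF g(3,2)])
  then show thesis using g that[of h p q c1 x c2] by simp
qed

lemma play_2n_plus_1:
  assumes "play g m" "length g = 2 * n + 1" "\<nu> (X_stones g) \<noteq> n"
  obtains h p q c1 y c2 z w where "decided_game R C n h p q" "g = h @ [p, q, c1, y, c2]"
    "decided_game.winning_plan R C n h p q c1 y c2 z w"
proof -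
  have "length g = Suc (2 * n)" "even (2 * n)" using assms(2) by simp_all
  then obtain g' c m' where g: "g = g' @ [c]" "length g' = 2 * n" "play g' m'"
    "(c, m) \<in> X_moves g' m'"
    using play_SucD[OF assms(1)] by (metis (full_types))
  obtain h p q c1 c2 x where h: "decided_game R C n h p q" "g' = h @ [p, q, c1, x]"
    "m' = Some c2" "decided_game.planned R C n h p c1 c2" "x \<in> free (h @ [p, q, c1])"
    using play_2n[OF g(3,2)] .
  interpret decided_game R C n h p q by fact
  have "\<nu> (insert c (X_stones g')) \<noteq> n" using assms(3) g(1,2) by simp
  then obtain z w where "c = c2" "winning_plan c1 x c2 z w"
    using second_reply(2)[OF h(4,5), of c m] g(4) unfolding h(2,3) by blast
  then show thesis using h g(1) that by simp
qed

lemma play_2n_plus_2: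
  assumes "play g m" "length g = 2 * n + 2"
  obtains h p q c1 y c2 z w x where "decided_game R C n h p q"
    "g = h @ [p, q, c1, y, c2, x]" "decided_game.winning_plan R C n h p q c1 y c2 z w"
    "x \<in> free (h @ [p, q, c1, y, c2])"
proof -
  have "length g = Suc (2 * n + 1)" "odd (2 * n + 1)" using assms(2) by simp_all
  then obtain g' x where g: "g = g' @ [x]" "length g' = 2 * n + 1" "play g' m" "x \<in> free g'"
    "\<not> game_over g'"
    using play_SucD[OF assms(1)] by (metis (full_types))
  have "\<nu> (X_stones g') \<noteq> n" using g(5) by (simp add: game_over_def)
  then obtain h p q c1 y c2 z w where "decided_game R C n h p q" "g' = h @ [p, q, c1, y, c2]"
    "decided_game.winning_plan R C n h p q c1 y c2 z w"
    by (rule play_2n_plus_1[OF g(3,2)])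
  then show thesis using g that[of h p q c1 y c2 x z w] by simp
qed

lemma play_2n_plus_3:
  assumes "play g m" "length g = 2 * n + 3"
  shows "game_over g"
proof -
  have "length g = Suc (2 * n + 2)" "even (2 * n + 2)" using assms(2) by simp_all
  then obtain g' c m' where g: "g = g' @ [c]" "length g' = 2 * n + 2" "play g' m'"
    "(c, m) \<in> X_moves g' m'"
    using play_SucD[OF assms(1)] by (metis (full_types))
  obtain h p q c1 y c2 z w x where h: "decided_game R C n h p q"
    "g' = h @ [p, q, c1, y, c2, x]" "decided_game.winning_plan R C n h p q c1 y c2 z w"
    using play_2n_plus_2[OF g(3,2)] .
  interpret decided_game R C n h p q by fact
  have "\<nu> (insert c (X_stones g')) = n"
    using final_reply(2)[OF h(3), of c m x m'] g(4) unfolding h(2) by blast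
  then show ?thesis using g(1,2) by (simp add: game_over_def)
qed

section \<open>Length of plays, safety against O, and availability of every move\<close>

lemma play_length:
  assumes "play g m"
  shows "length g \<le> 2 * n + 3"
proof (rule ccontr)
  assume "\<not> ?thesis"
  then have len: "Suc (2 * n + 3) \<le> length g" by simp
  \<comment> \<open>The play is cut at ply \<open>2n + 4\<close>; that ply would have been made
    although the game was over after ply \<open>2n + 3\<close>.\<close>
  obtain m' where "play (take (Suc (2 * n + 3)) g) m'" using play_prefix[OF assms len] by blast
  moreover have "length (take (Suc (2 * n + 3)) g) = Suc (2 * n + 3)" using len by simp
  ultimately obtain g' m'' where "length g' = 2 * n + 3" "play g' m''" "\<not> game_over g'"
    by (rule play_SucD)
  then show False using play_2n_plus_3 by blast
qed

text \<open>Before ply \<open>2n\<close> O has too few stones. At plies \<open>2n\<close> and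
  \<open>2n + 2\<close> the bound comes from the winning plan, and at plies \<open>2n + 1\<close>
  and \<open>2n + 3\<close> only X has added a stone since then.\<close>

lemma O_safe:
  assumes "play g m"
  shows "\<nu> (O_stones g) < n"
proof -
  have even_safe: "\<nu> (O_stones g) < n"
    if "play g m" "length g = 2 * n \<or> length g = 2 * n + 2" for g m
    using that(2)
  proof
    assume "length g = 2 * n"
    from play_2n[OF that(1) this] obtain h p q c1 c2 x
      where h: "decided_game R C n h p q" "g = h @ [p, q, c1, x]"
        "decided_game.planned R C n h p c1 c2" "x \<in> free (h @ [p, q, c1])" .
    interpret decided_game R C n h p q by fact
    show ?thesis using planned_wins[OF h(3)] O_safe_second[OF _ h(4)] h(2) by blast
  next
    assume "length g = 2 * n + 2"
    from play_2n_plus_2[OF that(1) this] obtain h p q c1 y c2 z w x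
      where h: "decided_game R C n h p q" "g = h @ [p, q, c1, y, c2, x]"
        "decided_game.winning_plan R C n h p q c1 y c2 z w" "x \<in> free (h @ [p, q, c1, y, c2])" .
    interpret decided_game R C n h p q by fact
    show ?thesis using O_safe_final[OF h(3,4)] h(2) by blast
  qed
  consider "length g \<le> 2 * n - 1" | "length g = 2 * n \<or> length g = 2 * n + 2"
    | "length g = Suc (2 * n) \<or> length g = Suc (2 * n + 2)"
    using play_length[OF assms] by linarith
  then show ?thesis
  proof cases
    case 1
    then have "length g div 2 < n" using n_ge_4 by linarith
    then show ?thesis
      using max_matching_le_card[of "O_stones g"] card_O_stones_le[of g] by simp
  next
    case 2
    then show ?thesis using even_safe[OF assms] by blast
  next
    case 3
    then obtain k where k: "length g = Suc k" "k = 2 * n \<or> k = 2 * n + 2" by blast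
    from play_SucD[OF assms k(1)] obtain g' c m' where g: "g = g' @ [c]" "length g' = k"
      "play g' m'" by metis
    then have "O_stones g = O_stones g'" using k(2) by auto
    then show ?thesis using even_safe[OF g(3)] g(2) k(2) by simp
  qed
qed

lemma strategy_wins: "strategy_wins_by_ply (2 * n + 3)"
  unfolding strategy_wins_by_ply_def
proof (intro allI impI)
  fix g m assume g: "play g m"
  have "free g \<noteq> {}" using play_length[OF g] by (rule free_nonempty)
  then show "length g \<le> 2 * n + 3 \<and> (game_over g \<or> free g = {} \<longrightarrow> won_by_X g)"
    using play_length[OF g] won_by_X_if[OF O_safe[OF g]] by simp
qed

lemma well_defined_at:
  assumes "play g m" "\<not> game_over g" "even (length g)"
  shows "X_moves g m \<noteq> {} \<and> (\<forall>(c, m')\<in>X_moves g m. c \<in> free g)"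
proof -
  obtain k where k: "length g = 2 * k" using assms(3) by (rule evenE)
  \<comment> \<open>An even length of at most \<open>2n + 3\<close> is at most
    \<open>2n + 2\<close>, so X is never asked for a move beyond its stone
    \<open>n + 2\<close>.\<close>
  then have "k \<le> n + 1" using play_length[OF assms(1)] by linarith
  then have "k + 1 \<le> n - 2 \<or> k = n - 2 \<or> k = n - 1 \<or> k = n \<or> k = n + 1"
    using n_ge_4 by linarith
  then consider "length g div 2 + 1 \<le> n - 2" | "length g = 2 * n - 4" | "length g = 2 * n - 2"
    | "length g = 2 * n" | "length g = 2 * n + 2"
    using k by fastforce
  then show ?thesis
  proof cases
    case 1
    then have "phase1_inv g" using play_phase1_inv[OF assms(1)] by linarith
    then have "phase1_cells g \<noteq> {}" using 1 assms(3) n_ge_4 by (intro phase1_cells_nonempty) auto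
    then show ?thesis using phase1_cells_open(1) X_moves_phase1[OF 1] by auto
  next
    case 2
    have "c \<in> free g" if "c \<in> tie_break_cells g" for c
      using that by (rule tie_break_cellsD) (simp add: admissible_outcome_def)
    moreover have "tie_break_cells g \<noteq> {}"
      using play_phase1_inv[OF assms(1)] 2 by (intro tie_break_nonempty) simp_all
    ultimately show ?thesis using X_moves_tie_break[OF 2] by auto
  next
    case 3
    obtain h p q x where h: "decided_game R C n h p q" "g = h @ [p, x]" "x \<in> free (h @ [p])"
      using play_2n_minus_2[OF assms(1) 3] .
    interpret decided_game R C n h p q by fact
    show ?thesis using first_reply[OF h(3), where m = m] unfolding h(2) by blast
  next
    case 4
    obtain h p q c1 c2 x where h: "decided_game R C n h p q" "g = h @ [p, q, c1, x]"
      "m = Some c2" "decided_game.planned R C n h p c1 c2" "x \<in> free (h @ [p, q, c1])"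
      using play_2n[OF assms(1) 4] .
    interpret decided_game R C n h p q by fact
    show ?thesis using second_reply[OF h(4,5)] unfolding h(2,3) by blast
  next
    case 5
    obtain h p q c1 y c2 z w x where h: "decided_game R C n h p q"
      "g = h @ [p, q, c1, y, c2, x]" "decided_game.winning_plan R C n h p q c1 y c2 z w"
      using play_2n_plus_2[OF assms(1) 5] .
    interpret decided_game R C n h p q by fact
    show ?thesis using final_reply[OF h(3)] unfolding h(2) by blast
  qed
qed

lemma well_defined: "strategy_well_defined"
  unfolding strategy_well_defined_def using well_defined_at by blast

end

theorem mainTheorem2:
  fixes R :: "'r set" and C :: "'c set" and n :: nat
  assumes "transversal_game R C n"
    and "n \<ge> 4"
  shows "transversal_game.strategy_well_defined R C n \<and>
         transversal_game.strategy_wins_by_ply R C n (2 * n + 3)"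
proof -
  interpret large_transversal_game R C n
    using assms by (simp add: large_transversal_game_def large_transversal_game_axioms_def)
  show ?thesis using well_defined strategy_wins by blast
qed

end
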